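(* For every prime $q$ there exists a stable set $S \subseteq \mathbb{N}$ with natural density $d(S) = 1 - \frac{1}{q-1}$ such that \[ S \cap (S+1) \cap (S+2) \cap \cdots \cap (S + q - 1) = \emptyset . \]
   Context: For $A \subseteq \mathbb{N}$, the natural density is $d(A) = \lim_{x\to\infty} \frac{|A \cap [1,x]|}{x}$ when the limit exists. For $h \in \mathbb{Z}$, $S + h = \{ s + h : s \in S\}$. A set $S \subseteq \mathbb{N}$ is called stable if for every prime $p$, \[ d\big(\{ n \in \mathbb{N} : \mathbb{1}_{n \in S} \neq \mathbb{1}_{pn \in S} \}\big) = 0, \] i.e. for every prime $p$, $n \in S$ if and only if $pn \in S$ for all $n$ outside a set of density $0$. *)

theory Defs
  imports Complex_Main "HOL-Computational_Algebra.Primes"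
begin

text \<open>The natural numbers are the positive integers here. They are represented inside type
  \<^typ>\<open>nat\<close>; the element \<open>0\<close> is never counted by the density.\<close>

definition has_natural_density :: "nat set \<Rightarrow> real \<Rightarrow> bool" where
  "has_natural_density A d \<longleftrightarrow>
     ((\<lambda>x::real. real (card {n \<in> A. 1 \<le> n \<and> real n \<le> x}) / x) \<longlongrightarrow> d) at_top"

text \<open>The shift is allowed to be any integer, so the shifted set is a set of integers.\<close>

definition shift_set :: "nat set \<Rightarrow> int \<Rightarrow> int set" where
  "shift_set S h = {int s + h | s. s \<in> S}"

definition stable_set :: "nat set \<Rightarrow> bool" where
  "stable_set S \<longleftrightarrow>
     (\<forall>p::nat. prime p \<longrightarrow> has_natural_density {n. (n \<in> S) \<noteq> (p * n \<in> S)} 0)"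

end

theory Submission
  imports Defs "HOL-Analysis.Kronecker_Approximation_Theorem"
    "HOL-Number_Theory.Residue_Primitive_Roots" "HOL-Real_Asymp.Real_Asymp"
begin

text \<open>
  Suppose a function \<open>b\<close> with values in the nonzero residues mod \<open>q\<close> is constant on long
  intervals and satisfies, for almost all \<open>n\<close>, \<open>b (p n) = p b n\<close> for primes \<open>p \<noteq> q\<close> and
  \<open>b (q n) = b n\<close>. Writing \<open>n = q\<^sup>k m\<close> with \<open>q\<close> not dividing \<open>m\<close>, the set \<open>T\<close> of all \<open>n\<close> with
  \<open>m = b n\<close> mod \<open>q\<close> is stable, has density \<open>1 / (q - 1)\<close>, and meets almost every window of \<open>q\<close>
  consecutive integers; so \<open>S\<close> is the complement of \<open>T\<close> with the exceptional windows removed.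

  To find \<open>b\<close>, take a primitive root \<open>g\<close> and \<open>b n = g\<^sup>c\<close> with \<open>c = \<lfloor>u ln n\<rfloor>\<close>, where Kronecker's
  theorem provides \<open>u\<close> such that \<open>u ln p\<close> is close mod \<open>q - 1\<close> to the discrete logarithm of \<open>p\<close>
  for all \<open>p \<le> k\<close>. This errs only for \<open>n\<close> with \<open>u ln n\<close> close to an integer. The frequency \<open>u\<close> must
  change as \<open>n\<close> grows, but an abrupt change from \<open>u\<close> to \<open>u'\<close> at \<open>N\<close> would spoil
  all \<open>n\<close> between \<open>N / p\<close> and \<open>N\<close>. Instead \<open>u'\<close> is used exactly when the fractional part of
  \<open>v ln n\<close> is below a threshold that moves from 0 to 1 in small steps; here all \<open>v ln p\<close> are
  close to integers, so that this choice is itself almost invariant under multiplication by \<open>p\<close>.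
\<close>

section \<open>Density and almost all integers\<close>

definition count_upto :: "nat set \<Rightarrow> nat \<Rightarrow> nat" where
  "count_upto A x = card (A \<inter> {1..x})"

lemma count_upto_mono: "A \<subseteq> B \<Longrightarrow> count_upto A x \<le> count_upto B x"
  unfolding count_upto_def by (intro card_mono) auto

lemma count_upto_le: "count_upto A x \<le> x"
proof -
  have "card (A \<inter> {1..x}) \<le> card {1..x}" by (intro card_mono) auto
  then show ?thesis by (simp add: count_upto_def)
qed

lemma count_upto_Un_le: "count_upto (A \<union> B) x \<le> count_upto A x + count_upto B x"
  unfolding count_upto_def by (metis Int_Un_distrib2 card_Un_le)

text \<open>The count up to a real \<open>x\<close> is the count up to
  \<open>nat \<lfloor>x\<rfloor>\<close>, whose ratio to \<open>x\<close> tends to 1, so a limit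
  along integers gives the limit along reals.\<close>

lemma has_natural_densityI:
  assumes "(\<lambda>x. real (count_upto A x) / real x) \<longlonglongrightarrow> d"
  shows "has_natural_density A d"
proof -
  have lim: "filterlim (\<lambda>x::real. nat \<lfloor>x\<rfloor>) sequentially at_top"
    using filterlim_compose[OF filterlim_nat_sequentially filterlim_floor_sequentially] by simp
  have "((\<lambda>x::real. real (count_upto A (nat \<lfloor>x\<rfloor>)) / real (nat \<lfloor>x\<rfloor>)) \<longlongrightarrow> d) at_top"
    by (rule filterlim_compose[OF assms lim])
  moreover have "((\<lambda>x::real. real (nat \<lfloor>x\<rfloor>) / x) \<longlongrightarrow> 1) at_top"
    by real_asymp
  ultimately have "((\<lambda>x::real. real (count_upto A (nat \<lfloor>x\<rfloor>)) / real (nat \<lfloor>x\<rfloor>)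
      * (real (nat \<lfloor>x\<rfloor>) / x)) \<longlongrightarrow> d * 1) at_top"
    by (rule tendsto_mult)
  moreover have "\<forall>\<^sub>F x::real in at_top. real (count_upto A (nat \<lfloor>x\<rfloor>)) / real (nat \<lfloor>x\<rfloor>)
      * (real (nat \<lfloor>x\<rfloor>) / x) = real (card {n \<in> A. 1 \<le> n \<and> real n \<le> x}) / x"
    using eventually_ge_at_top[of 1]
  proof eventually_elim
    case (elim x)
    have "{n \<in> A. 1 \<le> n \<and> real n \<le> x} = A \<inter> {1..nat \<lfloor>x\<rfloor>}"
      using elim by (auto simp: le_nat_iff le_floor_iff)
    moreover have "nat \<lfloor>x\<rfloor> > 0" using elim by simp
    ultimately show ?case by (simp add: count_upto_def)
  qed
  ultimately show ?thesis
    unfolding has_natural_density_def mult_1_right by (rule Lim_transform_eventually)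
qed

text \<open>Encoded as a filter so that \<open>eventually_elim\<close> merges finitely many
  exceptional sets; \<open>eventually_almost_all\<close> verifies the filter laws behind
  \<open>Abs_filter\<close>.\<close>

definition almost_all :: "nat filter" where
  "almost_all = Abs_filter (\<lambda>P. (\<lambda>x. real (count_upto {n. \<not> P n} x) / real x) \<longlonglongrightarrow> 0)"

lemma density_zero_subset:
  assumes "(\<lambda>x. real (count_upto B x) / real x) \<longlonglongrightarrow> 0" and "\<And>x. count_upto A x \<le> count_upto B x"
  shows "(\<lambda>x. real (count_upto A x) / real x) \<longlonglongrightarrow> 0"
  by (rule tendsto_sandwich[OF _ _ tendsto_const assms(1)])
     (auto intro!: always_eventually divide_right_mono assms(2))

lemma eventually_almost_all:
  "eventually P almost_all \<longleftrightarrow> (\<lambda>x. real (count_upto {n. \<not> P n} x) / real x) \<longlonglongrightarrow> 0"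
  unfolding almost_all_def
proof (rule eventually_Abs_filter, rule is_filter.intro, goal_cases)
  case 1
  then show ?case by (simp add: count_upto_def)
next
  case (2 P Q)
  have "(\<lambda>x. real (count_upto {n. \<not> P n} x) / real x + real (count_upto {n. \<not> Q n} x) / real x) \<longlonglongrightarrow> 0 + 0"
    by (intro tendsto_add 2)
  then have lim: "(\<lambda>x. real (count_upto {n. \<not> P n} x) / real x + real (count_upto {n. \<not> Q n} x) / real x) \<longlonglongrightarrow> 0"
    by simp
  have "{n. \<not> (P n \<and> Q n)} = {n. \<not> P n} \<union> {n. \<not> Q n}" by auto
  then have "real (count_upto {n. \<not> (P n \<and> Q n)} x) / real x
      \<le> real (count_upto {n. \<not> P n} x) / real x + real (count_upto {n. \<not> Q n} x) / real x" for x
    unfolding add_divide_distrib[symmetric] of_nat_add[symmetric]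
    by (intro divide_right_mono of_nat_mono) (simp_all add: count_upto_Un_le)
  then show ?case
    by (intro tendsto_sandwich[OF _ _ tendsto_const lim] always_eventually) auto
next
  case (3 P Q)
  show ?case by (rule density_zero_subset[OF 3(2)], rule count_upto_mono) (use 3(1) in auto)
qed

lemma has_natural_density_0I:
  "eventually (\<lambda>n. n \<notin> A) almost_all \<Longrightarrow> has_natural_density A 0"
  by (rule has_natural_densityI) (simp add: eventually_almost_all)

lemma eventually_almost_allI:
  assumes "\<And>e. e > 0 \<Longrightarrow> \<forall>\<^sub>F x in sequentially. real (count_upto {n. \<not> P n} x) \<le> e * real x"
  shows "eventually P almost_all"
  unfolding eventually_almost_all
proof (rule tendstoI)
  fix e :: real assume e: "e > 0"
  show "\<forall>\<^sub>F x in sequentially. dist (real (count_upto {n. \<not> P n} x) / real x) 0 < e"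
    using assms[OF half_gt_zero[OF e]] eventually_gt_at_top[of 0]
  proof eventually_elim
    case (elim x)
    then have "real (count_upto {n. \<not> P n} x) < e * real x"
      using e by (smt (verit) field_sum_of_halves mult_strict_right_mono of_nat_0_less_iff)
    then show ?case using elim by (simp add: divide_less_eq)
  qed
qed

lemma eventually_almost_allD:
  assumes "eventually P almost_all" "e > 0"
  shows "\<forall>\<^sub>F x in sequentially. real (count_upto {n. \<not> P n} x) \<le> e * real x"
  using tendstoD[OF assms(1)[unfolded eventually_almost_all] assms(2)] eventually_gt_at_top[of 0]
  by eventually_elim (simp add: divide_less_eq)

lemma eventually_almost_all_sequentially:
  assumes "eventually P sequentially"
  shows "eventually P almost_all"
proof (rule eventually_almost_allI)
  fix e :: real assume e: "e > 0"
  obtain N where N: "\<And>n. n \<ge> N \<Longrightarrow> P n" using assms by (auto simp: eventually_sequentially)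
  have "count_upto {n. \<not> P n} x \<le> N" for x
  proof -
    have "card ({n. \<not> P n} \<inter> {1..x}) \<le> card {..<N}"
      by (intro card_mono) (use N in \<open>auto simp: not_less[symmetric]\<close>)
    then show ?thesis by (simp add: count_upto_def)
  qed
  moreover have "\<forall>\<^sub>F x in sequentially. real N \<le> e * real x" using e by real_asymp
  ultimately show "\<forall>\<^sub>F x in sequentially. real (count_upto {n. \<not> P n} x) \<le> e * real x"
    by (auto elim!: eventually_mono intro: order_trans of_nat_mono)
qed

text \<open>Exceptions \<open>n \<le> x\<close> inject under \<open>n \<mapsto> p * n\<close> into
  the exceptions of \<open>P\<close> up to \<open>p * x\<close>, so tolerance \<open>e / p\<close>
  there gives \<open>e\<close> here.\<close>

lemma eventually_almost_all_mult:
  assumes "eventually P almost_all" "p > 0"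
  shows "eventually (\<lambda>n. P (p * n)) almost_all"
proof (rule eventually_almost_allI)
  fix e :: real assume e: "e > 0"
  let ?A = "{n. \<not> P n}"
  have le: "count_upto {n. \<not> P (p * n)} x \<le> count_upto ?A (p * x)" for x
    unfolding count_upto_def
    by (rule card_inj_on_le[where f = "\<lambda>n. p * n"]) (use assms(2) in \<open>auto simp: inj_on_def\<close>)
  have "filterlim (\<lambda>x. p * x) at_top sequentially"
    using assms(2) by (rule mult_nat_left_at_top)
  from eventually_compose_filterlim[OF eventually_almost_allD[OF assms(1), of "e / p"] this]
  have "\<forall>\<^sub>F x in sequentially. real (count_upto ?A (p * x)) \<le> e / p * real (p * x)"
    using e assms(2) by simp
  then show "\<forall>\<^sub>F x in sequentially. real (count_upto {n. \<not> P (p * n)} x) \<le> e * real x"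
    by eventually_elim (use le assms(2) in \<open>auto intro: order_trans[OF of_nat_mono]\<close>)
qed

lemma eventually_almost_all_shift:
  assumes "eventually P almost_all"
  shows "eventually (\<lambda>n. P (n + i)) almost_all"
proof (rule eventually_almost_allI)
  fix e :: real assume e: "e > 0"
  let ?A = "{n. \<not> P n}"
  have le: "count_upto {n. \<not> P (n + i)} x \<le> count_upto ?A (x + i)" for x
    unfolding count_upto_def
    by (rule card_inj_on_le[where f = "\<lambda>n. n + i"]) auto
  have "filterlim (\<lambda>x. x + i) at_top sequentially"
    by (rule filterlim_add_const_nat_at_top)
  from eventually_compose_filterlim[OF eventually_almost_allD[OF assms, of "e / 2"] this]
  have "\<forall>\<^sub>F x in sequentially. real (count_upto ?A (x + i)) \<le> e / 2 * real (x + i)"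
    using e by simp
  moreover have "\<forall>\<^sub>F x in sequentially. e / 2 * real (x + i) \<le> e * real x"
    using e by real_asymp
  ultimately show "\<forall>\<^sub>F x in sequentially. real (count_upto {n. \<not> P (n + i)} x) \<le> e * real x"
  proof eventually_elim
    case (elim x)
    then show ?case using of_nat_mono[OF le[of x], where ?'a = real] by linarith
  qed
qed

lemma eventually_almost_all_diff:
  assumes "eventually P almost_all"
  shows "eventually (\<lambda>n. P (n - i)) almost_all"
proof (rule eventually_almost_allI)
  fix e :: real assume e: "e > 0"
  let ?A = "{n. \<not> P n}"
  have le: "count_upto {n. \<not> P (n - i)} x \<le> i + count_upto ?A x" for x
  proof -
    \<comment> \<open>Truncated subtraction sends every \<open>n \<le> i\<close> to 0; these at most
      \<open>i\<close> values are counted separately.\<close>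
    have "{n. \<not> P (n - i)} \<inter> {1..x} \<subseteq> {1..i} \<union> (\<lambda>n. n + i) ` (?A \<inter> {1..x})"
    proof
      fix n assume n: "n \<in> {n. \<not> P (n - i)} \<inter> {1..x}"
      show "n \<in> {1..i} \<union> (\<lambda>n. n + i) ` (?A \<inter> {1..x})"
      proof (cases "n \<le> i")
        case False
        then have "n = (n - i) + i" "n - i \<in> ?A \<inter> {1..x}" using n by auto
        then show ?thesis by blast
      qed (use n in auto)
    qed
    then have "card ({n. \<not> P (n - i)} \<inter> {1..x}) \<le> card ({1..i} \<union> (\<lambda>n. n + i) ` (?A \<inter> {1..x}))"
      by (intro card_mono) auto
    also have "\<dots> \<le> card {1..i} + card (?A \<inter> {1..x})"
      by (intro order_trans[OF card_Un_le] add_mono card_image_le) auto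
    finally show ?thesis by (simp add: count_upto_def)
  qed
  have "\<forall>\<^sub>F x in sequentially. real i + e / 2 * real x \<le> e * real x"
    using e by real_asymp
  moreover have "\<forall>\<^sub>F x in sequentially. real (count_upto ?A x) \<le> e / 2 * real x"
    using e by (intro eventually_almost_allD[OF assms]) simp
  ultimately show "\<forall>\<^sub>F x in sequentially. real (count_upto {n. \<not> P (n - i)} x) \<le> e * real x"
  proof eventually_elim
    case (elim x)
    then show ?case using of_nat_mono[OF le[of x], where ?'a = real] by simp
  qed
qed

section \<open>Slowly varying phases\<close>

text \<open>The inequality is closed so that its negation gives a strict margin: distance greater
  than \<open>e\<close> from every integer.\<close>

definition near_int :: "real \<Rightarrow> real \<Rightarrow> bool" where
  "near_int e x \<longleftrightarrow> (\<exists>m::int. \<bar>x - of_int m\<bar> \<le> e)"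

lemma card_nat_between:
  fixes a b :: real
  assumes "0 \<le> a" "a \<le> b"
  shows "real (card {n::nat. a \<le> real n \<and> real n \<le> b}) \<le> b - a + 1"
proof -
  have "{n::nat. a \<le> real n \<and> real n \<le> b} = {nat \<lceil>a\<rceil>..nat \<lfloor>b\<rfloor>}"
    using assms by (auto simp: le_nat_iff le_floor_iff nat_le_iff ceiling_le_iff)
  then have "real (card {n::nat. a \<le> real n \<and> real n \<le> b}) = real (Suc (nat \<lfloor>b\<rfloor>) - nat \<lceil>a\<rceil>)"
    by simp
  also have "\<dots> \<le> b - a + 1"
  proof (cases "nat \<lceil>a\<rceil> \<le> Suc (nat \<lfloor>b\<rfloor>)")
    case True
    have "real (nat \<lfloor>b\<rfloor>) \<le> b" "a \<le> real (nat \<lceil>a\<rceil>)" using assms by linarith+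
    then show ?thesis using True by (simp add: of_nat_diff)
  next
    case False
    then have "Suc (nat \<lfloor>b\<rfloor>) - nat \<lceil>a\<rceil> = 0" by (simp del: nat_ceiling_le_eq)
    then show ?thesis using assms by simp
  qed
  finally show ?thesis .
qed

text \<open>The integers \<open>n\<close> in question fill short intervals around \<open>exp ((m + b) / u)\<close>, whose lengths
  are dominated by the gaps between consecutive centres.\<close>

lemma count_near_int:
  assumes u: "u \<ge> 1" and e: "e > 0"
  shows "\<forall>\<^sub>F x in sequentially.
    real (count_upto {n. near_int e (u * ln (real n) - b)} x) \<le> 200 * e * real x"
proof (cases "e \<le> 1")
  case False
  have "real (count_upto A x) \<le> 200 * e * real x" for A x
  proof -
    have "real (count_upto A x) \<le> 1 * real x" using count_upto_le by simp
    also have "\<dots> \<le> 200 * e * real x" using False by (intro mult_right_mono) auto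
    finally show ?thesis .
  qed
  then show ?thesis by simp
next
  case True
  \<comment> \<open>Since \<open>u * ln n \<ge> 0\<close> for \<open>n \<ge> 1\<close>, no integer
    below \<open>m0\<close> can be within \<open>e\<close> of \<open>u * ln n - b\<close>.\<close>
  define m0 where "m0 = \<lceil>- b - e\<rceil>"
  \<comment> \<open>The index is offset by one: \<open>A (Suc k)\<close> is the centre of the window
    \<open>W k\<close> and \<open>A k\<close> the preceding centre, so the gaps telescope.\<close>
  define A where "A = (\<lambda>k::nat. exp ((of_int m0 + real k - 1 + b) / u))"
  define t where "t = e / u"
  have t: "0 < t" "t \<le> 1" using u e True by (auto simp: t_def divide_le_eq)
  define W where "W = (\<lambda>k. {n::nat. A (Suc k) * exp (-t) \<le> real n \<and> real n \<le> A (Suc k) * exp t})"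
  have finW: "finite (W k)" for k
    by (rule finite_subset[of _ "{..nat \<lfloor>A (Suc k) * exp t\<rfloor>}"])
       (auto simp: W_def A_def le_nat_iff le_floor_iff)
  have cardW: "real (card (W k)) \<le> 12 * e * (A (Suc k) - A k) + 1" for k
  proof -
    have "real (card (W k)) \<le> A (Suc k) * exp t - A (Suc k) * exp (-t) + 1"
      unfolding W_def by (rule card_nat_between) (use t in \<open>auto simp: A_def\<close>)
    also have "\<dots> = A (Suc k) * (exp t - exp (-t)) + 1" by (simp add: algebra_simps)
    also have "exp t - exp (-t) \<le> 6 * t"
    proof -
      have "exp t - exp (-t) = exp t * (1 - exp (- (2 * t)))"
        by (simp add: algebra_simps exp_add[symmetric])
      also have "\<dots> \<le> exp t * (2 * t)"
        using exp_ge_add_one_self[of "-(2*t)"] by (intro mult_left_mono) auto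
      also have "\<dots> \<le> 3 * (2 * t)"
      proof (intro mult_right_mono)
        have "exp t \<le> exp 1" using t by simp
        then show "exp t \<le> 3" using exp_le by linarith
      qed (use t in auto)
      finally show ?thesis by simp
    qed
    \<comment> \<open>The gap before \<open>A (Suc k)\<close> is the fraction
      \<open>1 - exp (- (1 / u))\<close> of it, at least \<open>1 / (2 * u)\<close> because
      \<open>u \<ge> 1\<close>; so a window of relative width \<open>O(e / u)\<close> is
      \<open>O(e)\<close> gaps long.\<close>
    also have "6 * t \<le> 12 * e * (1 - exp (- (1 / u)))"
    proof -
      have s: "0 < 1 / u" "1 / u \<le> 1" using u by auto
      have "exp (- (1 / u)) \<le> 1 / (1 + 1 / u)"
        unfolding exp_minus inverse_eq_divide
        using exp_ge_add_one_self[of "1 / u"] s by (intro divide_left_mono mult_pos_pos add_pos_pos) auto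
      also have "\<dots> \<le> 1 - 1 / u / 2"
        using s u by (simp add: field_simps)
      finally have "1 / u / 2 \<le> 1 - exp (- (1 / u))" by simp
      then have "12 * e * (1 / u / 2) \<le> 12 * e * (1 - exp (- (1 / u)))"
        using e by (intro mult_left_mono) auto
      then show ?thesis by (simp add: t_def)
    qed
    finally have "real (card (W k)) \<le> A (Suc k) * (12 * e * (1 - exp (- (1 / u)))) + 1"
      by (simp add: A_def)
    also have "A (Suc k) * (12 * e * (1 - exp (- (1 / u)))) = 12 * e * (A (Suc k) - A (Suc k) * exp (- (1 / u)))"
      by (simp add: algebra_simps)
    also have "A (Suc k) * exp (- (1 / u)) = A k"
      unfolding A_def exp_add[symmetric] by (simp add: diff_divide_distrib add_divide_distrib)
    finally show ?thesis .
  qed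
  have main: "real (count_upto {n. near_int e (u * ln (real n) - b)} x)
      \<le> 108 * e * real x + (u * ln (real x) + 3)" if x: "x \<ge> 1" for x
  proof -
    \<comment> \<open>Bounds \<open>m - m0\<close>, as \<open>m \<le> u * ln x - b + e\<close> and
      \<open>m0 \<ge> - b - e\<close>.\<close>
    define K where "K = nat \<lfloor>u * ln (real x) + 2 * e\<rfloor>"
    have lnx: "u * ln (real x) \<ge> 0" using x u by simp
    have K: "real K \<le> u * ln (real x) + 2 * e"
      unfolding K_def using lnx e by simp
    have sub: "{n. near_int e (u * ln (real n) - b)} \<inter> {1..x} \<subseteq> (\<Union>k<Suc K. W k)"
    proof
      fix n assume "n \<in> {n. near_int e (u * ln (real n) - b)} \<inter> {1..x}"
      then obtain m :: int where n: "1 \<le> n" "n \<le> x" and m: "\<bar>u * ln (real n) - b - of_int m\<bar> \<le> e"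
        by (auto simp: near_int_def)
      have ln0: "0 \<le> u * ln (real n)" "u * ln (real n) \<le> u * ln (real x)"
        using n u by (auto intro!: mult_left_mono)
      have mge: "m0 \<le> m"
        unfolding m0_def using m ln0 by (simp add: ceiling_le_iff)
      have "of_int (m - m0) \<le> u * ln (real x) + 2 * e"
        unfolding m0_def using m ln0 by (simp, linarith)
      then have mle: "nat (m - m0) \<le> K" unfolding K_def
        by (intro nat_mono) (simp add: le_floor_iff)
      have Aeq: "A (Suc (nat (m - m0))) = exp ((of_int m + b) / u)"
        unfolding A_def using mge by simp
      have "ln (real n) - (of_int m + b) / u = (u * ln (real n) - b - of_int m) / u"
        using u by (simp add: diff_divide_distrib add_divide_distrib)
      also have "\<bar>\<dots>\<bar> \<le> t"
        unfolding t_def abs_divide using m u by (simp add: divide_right_mono)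
      finally have "(of_int m + b) / u - t \<le> ln (real n)" "ln (real n) \<le> (of_int m + b) / u + t"
        by linarith+
      then have "exp ((of_int m + b) / u - t) \<le> real n" "real n \<le> exp ((of_int m + b) / u + t)"
        using n exp_ln[of "real n"] exp_le_cancel_iff[of "ln (real n)"] by (simp_all add: ln_ge_iff)
      then have "n \<in> W (nat (m - m0))"
        unfolding W_def Aeq mem_Collect_eq exp_add[symmetric] by simp
      then show "n \<in> (\<Union>k<Suc K. W k)" using mle by (auto simp: less_Suc_eq_le)
    qed
    have "real (count_upto {n. near_int e (u * ln (real n) - b)} x) \<le> real (card (\<Union>k<Suc K. W k))"
      unfolding count_upto_def by (intro of_nat_mono card_mono sub) (auto intro: finW)
    also have "\<dots> \<le> real (\<Sum>k<Suc K. card (W k))"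
      by (intro of_nat_mono card_UN_le) auto
    also have "\<dots> = (\<Sum>k<Suc K. real (card (W k)))" by simp
    also have "\<dots> \<le> (\<Sum>k<Suc K. 12 * e * (A (Suc k) - A k) + 1)"
      by (intro sum_mono cardW)
    also have "\<dots> = 12 * e * (A (Suc K) - A 0) + real (Suc K)"
      by (simp only: sum.distrib sum_distrib_left[symmetric] sum_lessThan_telescope) simp
    also have "A (Suc K) - A 0 \<le> 9 * real x"
    proof -
      have "A (Suc K) \<le> exp (ln (real x) + 2)"
      proof -
        have "of_int m0 + real K + b \<le> u * ln (real x) + 2 * u"
          unfolding m0_def using K u True e by linarith
        then show ?thesis unfolding A_def using u by (simp add: divide_le_eq algebra_simps)
      qed
      also have "\<dots> = real x * (exp 1 * exp 1)"
        using x by (simp add: exp_add mult_exp_exp)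
      also have "\<dots> \<le> real x * (3 * 3)"
        using exp_le by (intro mult_left_mono mult_mono) auto
      finally show ?thesis using exp_gt_zero[of "(of_int m0 + real 0 - 1 + b) / u"] unfolding A_def by linarith
    qed
    finally have "real (count_upto {n. near_int e (u * ln (real n) - b)} x)
       \<le> 12 * e * (9 * real x) + real (Suc K)" using e by simp
    also have "real (Suc K) \<le> u * ln (real x) + 3" using K True by simp
    finally show ?thesis by simp
  qed
  \<comment> \<open>The windows contribute \<open>12 * 9 = 108\<close> times \<open>e * x\<close>;
    the remaining 92 absorb the rounding error of 1 per window, of which there are only
    logarithmically many.\<close>
  have "\<forall>\<^sub>F x::nat in sequentially. u * ln (real x) + 3 \<le> 92 * e * real x"
    using u e by real_asymp
  then show ?thesis using eventually_ge_at_top[of 1]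
  proof eventually_elim
    case (elim x)
    show ?case using main[OF elim(2)] elim(1) by linarith
  qed
qed

section \<open>Simultaneous approximation of multiples of logarithms of primes\<close>

text \<open>Unique factorization: separating positive and negative coefficients and exponentiating
  gives two equal products of prime powers. Comparing the exponents of \<open>p\<close> gives
  \<open>nat (k p) = nat (- k p)\<close>, which forces both to vanish.\<close>

lemma ln_primes_independent:
  fixes k :: "nat \<Rightarrow> int"
  assumes "finite S" "\<And>p. p \<in> S \<Longrightarrow> prime p" "(\<Sum>p\<in>S. of_int (k p) * ln (real p)) = 0" "p \<in> S"
  shows "k p = 0"
proof -
  define A where "A = (\<Prod>p\<in>S. p ^ nat (k p))"
  define B where "B = (\<Prod>p\<in>S. p ^ nat (- k p))"
  have pos: "\<And>p. p \<in> S \<Longrightarrow> p > 0" using assms(2) prime_gt_0_nat by blast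
  have "ln (real (\<Prod>p\<in>S. p ^ f p)) = (\<Sum>p\<in>S. real (f p) * ln (real p))" for f :: "nat \<Rightarrow> nat"
    using pos assms(1) by (simp add: ln_prod ln_realpow)
  then have "ln (real A) - ln (real B) = (\<Sum>p\<in>S. real (nat (k p)) * ln (real p) - real (nat (- k p)) * ln (real p))"
    unfolding A_def B_def sum_subtractf by metis
  also have "\<dots> = (\<Sum>p\<in>S. of_int (k p) * ln (real p))"
  proof (intro sum.cong refl)
    show "real (nat (k p)) * ln (real p) - real (nat (- k p)) * ln (real p) = of_int (k p) * ln (real p)" for p
      by (cases "k p \<ge> 0") auto
  qed
  finally have "ln (real A) = ln (real B)" using assms(3) by simp
  moreover have "A > 0" "B > 0" using pos by (auto simp: A_def B_def intro!: prod_pos)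
  ultimately have "A = B" by simp
  moreover have "multiplicity p A = nat (k p)" "multiplicity p B = nat (- k p)"
    unfolding A_def B_def using assms by (simp_all add: multiplicity_prod_prime_powers)
  ultimately have "nat (k p) = nat (- k p)" by simp
  then show ?thesis by linarith
qed

text \<open>Kronecker's theorem fixes the residues of \<open>t ln p\<close>; adding a large \<open>s\<close> for which all
  \<open>s ln p\<close> are nearly integers, given by Dirichlet's theorem, makes \<open>t\<close> large.\<close>

lemma approx_ln_primes:
  fixes \<alpha> :: "nat \<Rightarrow> real"
  assumes "e > 0"
  obtains t where "t \<ge> L" "\<And>p. prime p \<Longrightarrow> p \<le> P \<Longrightarrow> \<exists>h::int. \<bar>t * ln (real p) - \<alpha> p - of_int h\<bar> < e"
proof -
  define S where "S = {p. prime p \<and> p \<le> P}"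
  have "finite S" by (rule finite_subset[of _ "{..P}"]) (auto simp: S_def)
  define n where "n = card S"
  obtain f where f: "bij_betw f {..<n} S"
    using ex_bij_betw_nat_finite[OF \<open>finite S\<close>] by (auto simp: n_def atLeast0LessThan)
  define \<theta> where "\<theta> = (\<lambda>i. ln (real (f i)))"
  have fS: "prime (f i)" if "i < n" for i using f that by (auto simp: bij_betw_def S_def)
  have inj_ln: "inj_on (\<lambda>p. ln (real p)) S"
    by (auto simp: inj_on_def S_def prime_gt_0_nat)
  have img: "\<theta> ` {..<n} = (\<lambda>p. ln (real p)) ` S"
    using f by (auto simp: \<theta>_def bij_betw_def)
  \<comment> \<open>Regarding the reals as a module over the integers makes
    \<open>independent\<close> the integer linear independence that Kronecker's theorem
    demands.\<close>
  interpret Modules.module "\<lambda>r. (*) (real_of_int r)"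
    by (simp add: Modules.module.intro distrib_left mult.commute)
  have "independent (\<theta> ` {..<n})"
    unfolding independent_explicit_module img
  proof (intro allI impI)
    fix T u v
    assume T: "finite T" "T \<subseteq> (\<lambda>p. ln (real p)) ` S" "(\<Sum>v\<in>T. real_of_int (u v) * v) = 0" "v \<in> T"
    obtain S' where S': "S' \<subseteq> S" "T = (\<lambda>p. ln (real p)) ` S'"
      using T(2) by (meson subset_imageE)
    have fin: "finite S'" using S' \<open>finite S\<close> finite_subset by blast
    have "(\<Sum>p\<in>S'. real_of_int (u (ln (real p))) * ln (real p)) = 0"
      using T(3) unfolding S'(2) by (subst (asm) sum.reindex) (use inj_ln S' inj_on_subset in auto)
    from ln_primes_independent[OF fin _ this] show "u v = 0"
      using T(4) S' by (auto simp: S_def)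
  qed
  moreover have "inj_on \<theta> {..<n}"
    unfolding \<theta>_def using comp_inj_on[of f "{..<n}" "\<lambda>p. ln (real p)"] f inj_ln
    by (auto simp: bij_betw_def comp_def)
  ultimately obtain t h where t: "\<And>i. i < n \<Longrightarrow> \<bar>t * \<theta> i - of_int (h i) - \<alpha> (f i)\<bar> < e / 2"
    using Kronecker_thm_1[of \<theta> n "e / 2" "\<lambda>i. \<alpha> (f i)"] assms by auto
  obtain N :: nat where N: "N > 0" "1 / real N < e / 2"
    using assms by (metis half_gt_zero inverse_eq_divide real_arch_inverse gr0I)
  \<comment> \<open>Adding any positive integer multiple of \<open>b\<close> lifts \<open>t\<close>
    above \<open>L\<close>; Dirichlet's theorem for the numbers \<open>b * \<theta> i\<close> finds
    a multiple that hardly disturbs the residues.\<close>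
  define b where "b = \<bar>t\<bar> + \<bar>L\<bar>"
  obtain q r where q: "0 < q" "\<And>i. i < n \<Longrightarrow> \<bar>of_int q * (b * \<theta> i) - of_int (r i)\<bar> < 1 / real N"
    using Dirichlet_approx_simult[OF N(1), of n "\<lambda>i. b * \<theta> i"] by metis
  show ?thesis
  proof (rule that[of "t + of_int q * b"])
    have "1 * b \<le> of_int q * b" using q(1) by (intro mult_right_mono) (auto simp: b_def)
    then show "L \<le> t + of_int q * b" by (auto simp: b_def)
  next
    fix p assume "prime p" "p \<le> P"
    then have "p \<in> f ` {..<n}" using f by (simp add: S_def bij_betw_def)
    then obtain i where i: "i < n" "f i = p" by auto
    have "\<bar>(t + of_int q * b) * ln (real p) - \<alpha> p - of_int (h i + r i)\<bar> < e"
    proof -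
      have "(t + of_int q * b) * ln (real p) - \<alpha> p - of_int (h i + r i)
          = (t * \<theta> i - of_int (h i) - \<alpha> (f i)) + (of_int q * (b * \<theta> i) - of_int (r i))"
        by (simp add: \<theta>_def i(2) algebra_simps)
      then show ?thesis using t[OF i(1)] q(2)[OF i(1)] N(2) by linarith
    qed
    then show "\<exists>h::int. \<bar>(t + of_int q * b) * ln (real p) - \<alpha> p - of_int h\<bar> < e" by blast
  qed
qed

section \<open>Mixing two frequencies by a moving threshold\<close>

text \<open>Distance more than \<open>e\<close> from the integers on both sides leaves room for the
  error \<open>d - a\<close>, so after translation by \<open>a\<close> no integer is
  crossed.\<close>

lemma floor_add_near_int:
  fixes a :: int
  assumes "\<not> near_int e x" "\<bar>d - of_int a\<bar> < e"
  shows "\<lfloor>x + d\<rfloor> = \<lfloor>x\<rfloor> + a"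
proof -
  have "\<bar>x - of_int \<lfloor>x\<rfloor>\<bar> > e" "\<bar>x - of_int (\<lfloor>x\<rfloor> + 1)\<bar> > e"
    using assms(1) unfolding near_int_def not_ex not_le by blast+
  then have "x - of_int \<lfloor>x\<rfloor> > e" "of_int (\<lfloor>x\<rfloor> + 1) - x > e"
    by linarith+
  then show ?thesis using assms(2) by (simp add: floor_eq_iff, linarith)
qed

text \<open>In its uses \<open>y\<close> is \<open>ln n\<close>. The thresholds 0 and 1 give the
  pure frequencies \<open>u\<close> and \<open>u'\<close>, so successive transitions can be joined
  without a jump.\<close>

definition mixed_phase :: "real \<Rightarrow> real \<Rightarrow> real \<Rightarrow> real \<Rightarrow> real \<Rightarrow> int" where
  "mixed_phase v u u' l y = (if frac (v * y) < l then \<lfloor>u' * y\<rfloor> else \<lfloor>u * y\<rfloor>)"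

lemma mixed_phase_0 [simp]: "mixed_phase v u u' 0 y = \<lfloor>u * y\<rfloor>"
  unfolding mixed_phase_def using frac_ge_0[of "v * y"] by (simp only: not_less[symmetric] if_False)

lemma mixed_phase_1 [simp]: "mixed_phase v u u' 1 y = \<lfloor>u' * y\<rfloor>"
  by (simp add: mixed_phase_def frac_lt_1)

text \<open>The shift by \<open>d\<close> and the change of threshold from \<open>l\<close> to
  \<open>l'\<close> happen together. The fractional part moves by less than \<open>e\<close> and the
  threshold by at most \<open>\<eta> - e\<close>, while they start more than \<open>\<eta>\<close>
  apart; hence both sides take the same branch, where the floor changes by \<open>\<alpha>\<close>
  modulo \<open>M\<close>.\<close>

lemma mixed_phase_shift:
  fixes \<alpha> M h h' h'' :: int
  assumes "\<not> near_int \<eta> (u * y)" "\<bar>u * d - of_int (\<alpha> + M * h)\<bar> < e"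
    and "\<not> near_int \<eta> (u' * y)" "\<bar>u' * d - of_int (\<alpha> + M * h')\<bar> < e"
    and "\<not> near_int \<eta> (v * y)" "\<not> near_int \<eta> (v * y - l)" "\<bar>v * d - of_int h''\<bar> < e"
    and "l \<le> l'" "l' - l + e \<le> \<eta>"
  shows "[mixed_phase v u u' l' (y + d) = mixed_phase v u u' l y + \<alpha>] (mod M)"
proof -
  have fl: "\<lfloor>x + w\<rfloor> = \<lfloor>x\<rfloor> + a" if "\<not> near_int \<eta> x" "\<bar>w - of_int a\<bar> < e" for x w a
    using that assms(8,9) by (intro floor_add_near_int[of \<eta>]) linarith+
  have fr: "frac (v * (y + d)) = frac (v * y) + (v * d - of_int h'')"
    using fl[OF assms(5,7)] by (simp add: frac_def distrib_left)
  have "\<eta> < \<bar>v * y - l - of_int \<lfloor>v * y\<rfloor>\<bar>"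
    using assms(6) unfolding near_int_def not_ex not_le by blast
  then have "\<bar>frac (v * y) - l\<bar> > \<eta>" by (simp add: frac_def algebra_simps)
  then have "frac (v * (y + d)) < l' \<longleftrightarrow> frac (v * y) < l"
    unfolding fr using assms by linarith
  moreover have "\<lfloor>u * (y + d)\<rfloor> = \<lfloor>u * y\<rfloor> + (\<alpha> + M * h)"
    using fl[OF assms(1,2)] by (simp add: distrib_left)
  moreover have "\<lfloor>u' * (y + d)\<rfloor> = \<lfloor>u' * y\<rfloor> + (\<alpha> + M * h')"
    using fl[OF assms(3,4)] by (simp add: distrib_left)
  ultimately show ?thesis
    by (auto simp: mixed_phase_def cong_iff_dvd_diff)
qed

section \<open>Gluing infinitely many stages\<close>

text \<open>A diagonal argument: \<open>I n\<close> is the stage in force at \<open>n\<close>.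
  Stages last so long that each one after stage 0 has its eventual properties from its start, and
  that multiplying a large \<open>n\<close> by a fixed \<open>K\<close> crosses at most one
  boundary. Up to \<open>x\<close>, all but the last two stages fill a negligible initial segment,
  so only two sets \<open>B i\<close> matter.\<close>

lemma glue_stages:
  fixes B :: "nat \<Rightarrow> nat set" and Q :: "nat \<Rightarrow> nat \<Rightarrow> bool" and \<epsilon> :: "nat \<Rightarrow> real"
  assumes Q: "\<And>i. eventually (Q i) sequentially"
    and B: "\<And>i. \<forall>\<^sub>F x in sequentially. real (count_upto (B i) x) \<le> \<epsilon> i * real x"
    and \<epsilon>: "\<epsilon> \<longlonglongrightarrow> 0"
  obtains I where "filterlim I at_top sequentially" "\<forall>\<^sub>F n in sequentially. Q (I n) n"
    and "\<And>K. \<forall>\<^sub>F n in sequentially. \<forall>m\<in>{n..K * n}. I m = I n \<or> I m = Suc (I n)"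
    and "\<forall>\<^sub>F n in almost_all. n \<notin> B (I n)"
proof -
  have "\<forall>i. \<exists>X. \<forall>n\<ge>X. Q i n \<and> real (count_upto (B i) n) \<le> \<epsilon> i * real n"
    using eventually_conj[OF Q B] by (auto simp: eventually_sequentially)
  then obtain X where X: "\<And>i n. n \<ge> X i \<Longrightarrow> Q i n"
      "\<And>i n. n \<ge> X i \<Longrightarrow> real (count_upto (B i) n) \<le> \<epsilon> i * real n"
    by metis
  \<comment> \<open>The factor \<open>Suc i\<close> makes the ratios of consecutive starting points
    unbounded, \<open>X (Suc i)\<close> delays a stage until its estimates hold, and 1 makes
    \<open>N\<close> strictly increasing. Stage 0 starts at 0 without waiting for
    \<open>X 0\<close>.\<close>
  define N where "N = rec_nat 0 (\<lambda>i a. Suc i * a + X (Suc i) + 1)"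
  have N0: "N 0 = 0" and NS: "\<And>i. N (Suc i) = Suc i * N i + X (Suc i) + 1"
    by (simp_all add: N_def)
  have Nmono: "strict_mono N" by (rule strict_monoI_Suc) (simp add: NS)
  have NX: "X i \<le> N i" if "i > 0" for i using that NS by (cases i) auto
  define I where "I = (\<lambda>n. GREATEST i. N i \<le> n)"
  have bd: "\<And>i n. N i \<le> n \<Longrightarrow> i \<le> n"
    using strict_mono_imp_increasing[OF Nmono] order_trans by blast
  have NI: "N (I n) \<le> n" for n
    unfolding I_def by (rule GreatestI_nat[where k = 0 and b = n]) (use bd N0 in auto)
  have le_I: "i \<le> I n" if "N i \<le> n" for i n
    unfolding I_def by (rule Greatest_le_nat[where b = n]) (use bd that in auto)
  have I_less: "n < N i" if "I n < i" for i n
    using le_I[of i n] that by (meson not_le)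
  have I_mono: "I m \<le> I n" if "m \<le> n" for m n
    using le_I NI that order_trans by blast
  have I_lim: "filterlim I at_top sequentially"
    unfolding filterlim_at_top
  proof
    fix Z show "\<forall>\<^sub>F x in sequentially. Z \<le> I x"
      using eventually_ge_at_top[of "N Z"] by eventually_elim (rule le_I)
  qed
  show ?thesis
  proof (rule that[OF I_lim])
    show "\<forall>\<^sub>F n in sequentially. Q (I n) n"
      using filterlim_at_top[THEN iffD1, OF I_lim, rule_format, of 1]
    proof eventually_elim
      case (elim n)
      then have "X (I n) \<le> n" using NX[of "I n"] NI[of n] by simp
      then show ?case by (rule X)
    qed
  next
    fix K
    show "\<forall>\<^sub>F n in sequentially. \<forall>m\<in>{n..K * n}. I m = I n \<or> I m = Suc (I n)"
      using filterlim_at_top[THEN iffD1, OF I_lim, rule_format, of K]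
    proof eventually_elim
      case (elim n)
      show ?case
      proof
        fix m assume m: "m \<in> {n..K * n}"
        have "n < N (Suc (I n))" by (rule I_less) simp
        \<comment> \<open>With \<open>K \<le> I n\<close> and \<open>n\<close> before stage
          \<open>Suc (I n)\<close>, the factor in the recursion puts \<open>m\<close> before stage
          \<open>Suc (Suc (I n))\<close>.\<close>
        have "m \<le> Suc (Suc (I n)) * n" using m mult_right_mono[of K "Suc (Suc (I n))" n] elim by simp
        also have "\<dots> \<le> Suc (Suc (I n)) * N (Suc (I n))"
          using \<open>n < N (Suc (I n))\<close> by (intro mult_left_mono) auto
        also have "\<dots> < N (Suc (Suc (I n)))" by (simp add: NS[of "Suc (I n)"])
        finally have "I m < Suc (Suc (I n))"
          using NI[of m] strict_mono_less[OF Nmono, of "I m" "Suc (Suc (I n))"] by simp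
        moreover have "I n \<le> I m" using I_mono m by simp
        ultimately show "I m = I n \<or> I m = Suc (I n)" by linarith
      qed
    qed
  next
    show "\<forall>\<^sub>F n in almost_all. n \<notin> B (I n)"
    proof (rule eventually_almost_allI)
      fix e :: real assume e: "e > 0"
      have "\<forall>\<^sub>F j in sequentially. \<epsilon> j < e / 3" using \<epsilon> e by (intro order_tendstoD) auto
      then obtain J where J: "\<And>j. j \<ge> J \<Longrightarrow> \<epsilon> j < e / 3" by (auto simp: eventually_sequentially)
      obtain R :: nat where R: "R > 3 / e" using reals_Archimedean2 by blast
      have "\<forall>\<^sub>F x in sequentially. J + R + 2 \<le> I x"
        using filterlim_at_top[THEN iffD1, OF I_lim] by blast
      then show "\<forall>\<^sub>F x in sequentially. real (count_upto {n. \<not> n \<notin> B (I n)} x) \<le> e * real x"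
      proof eventually_elim
        case (elim x)
        then obtain j where j: "I x = Suc j" by (cases "I x") auto
        then have jJ: "j \<ge> J" "j \<ge> R" "j > 0" using elim by auto
        have Nx: "N (Suc j) \<le> x" using NI[of x] j by simp
        have sub: "{n. n \<in> B (I n)} \<inter> {1..x}
            \<subseteq> {1..N j} \<union> (B j \<inter> {1..x} \<union> B (Suc j) \<inter> {1..x})"
        proof
          fix n assume n: "n \<in> {n. n \<in> B (I n)} \<inter> {1..x}"
          show "n \<in> {1..N j} \<union> (B j \<inter> {1..x} \<union> B (Suc j) \<inter> {1..x})"
          proof (cases "n \<le> N j")
            case False
            then have "j \<le> I n" by (intro le_I) simp
            moreover have "I n \<le> Suc j" using I_mono[of n x] n j by simp
            ultimately have "I n = j \<or> I n = Suc j" by linarith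
            then show ?thesis using n by auto
          qed (use n in auto)
        qed
        have "card ({n. n \<in> B (I n)} \<inter> {1..x})
            \<le> card ({1..N j} \<union> (B j \<inter> {1..x} \<union> B (Suc j) \<inter> {1..x}))"
          by (intro card_mono sub) auto
        also have "\<dots> \<le> card {1..N j} + (card (B j \<inter> {1..x}) + card (B (Suc j) \<inter> {1..x}))"
          by (intro order_trans[OF card_Un_le] add_mono card_Un_le order_refl)
        finally have "real (count_upto {n. n \<in> B (I n)} x)
            \<le> real (N j) + real (count_upto (B j) x) + real (count_upto (B (Suc j)) x)"
          by (simp add: count_upto_def)
        moreover have "N j \<le> N (Suc j)" using Nmono by (simp add: strict_mono_less_eq)
        then have "real (count_upto (B j) x) \<le> \<epsilon> j * real x"
          by (intro X(2)) (use NX[of j] jJ Nx in linarith)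
        then have "real (count_upto (B j) x) \<le> e / 3 * real x"
          by (rule order_trans) (use J[of j] jJ in \<open>intro mult_right_mono, auto\<close>)
        moreover have "real (count_upto (B (Suc j)) x) \<le> \<epsilon> (Suc j) * real x"
          by (intro X(2)) (use NX[of "Suc j"] Nx in linarith)
        then have "real (count_upto (B (Suc j)) x) \<le> e / 3 * real x"
          by (rule order_trans) (use J[of "Suc j"] jJ in \<open>intro mult_right_mono, auto\<close>)
        moreover have "real (N j) \<le> e / 3 * real x"
        proof -
          have "3 / e * real (N j) \<le> real (Suc j) * real (N j)"
            using R jJ by (intro mult_right_mono) auto
          also have "\<dots> \<le> real (N (Suc j))" unfolding of_nat_mult[symmetric] NS by (intro of_nat_mono) simp
          also have "\<dots> \<le> real x" using Nx by simp
          finally show ?thesis using e by (simp add: field_simps)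
        qed
        ultimately show ?case by simp
      qed
    qed
  qed
qed

section \<open>Construction of the slowly varying exponent\<close>

text \<open>Supplies the exponent of the primitive root, with \<open>M = q - 1\<close> and
  \<open>\<alpha> p\<close> a discrete logarithm. Stage \<open>i\<close> mixes the frequencies
  \<open>u (K i)\<close> and \<open>u (Suc (K i))\<close>, both tuned to the primes up to
  \<open>K i\<close>.\<close>

lemma exists_slow_phase:
  fixes \<alpha> :: "nat \<Rightarrow> int" and M :: int
  assumes M: "M > 0"
  obtains c :: "nat \<Rightarrow> int"
  where "\<And>p. prime p \<Longrightarrow> \<forall>\<^sub>F n in almost_all. [c (p * n) = c n + \<alpha> p] (mod M)"
    and "\<forall>\<^sub>F n in almost_all. [c (Suc n) = c n] (mod M)"
proof -
  define \<epsilon> where "\<epsilon> = (\<lambda>k::nat. 1 / (real k + 1))"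
  have \<epsilon>: "\<epsilon> k > 0" for k by (simp add: \<epsilon>_def)
  have "\<exists>u\<ge>1. \<forall>p. prime p \<longrightarrow> p \<le> k \<longrightarrow> (\<exists>h::int. \<bar>u * ln (real p) - of_int (\<alpha> p + M * h)\<bar> < \<epsilon> k)" for k
  proof -
    \<comment> \<open>Kronecker's theorem works modulo 1, so \<open>\<alpha> p / M\<close> is
      approximated with tolerance \<open>\<epsilon> k / M\<close> and the frequency found is
      multiplied by \<open>M\<close>.\<close>
    obtain t where t: "t \<ge> 1"
        "\<And>p. prime p \<Longrightarrow> p \<le> k \<Longrightarrow> \<exists>h::int. \<bar>t * ln (real p) - of_int (\<alpha> p) / of_int M - of_int h\<bar> < \<epsilon> k / of_int M"
      using approx_ln_primes[of "\<epsilon> k / of_int M" 1 k "\<lambda>p. of_int (\<alpha> p) / of_int M"] \<epsilon> M by auto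
    have "\<exists>h::int. \<bar>of_int M * t * ln (real p) - of_int (\<alpha> p + M * h)\<bar> < \<epsilon> k" if "prime p" "p \<le> k" for p
    proof -
      obtain h :: int where h: "\<bar>t * ln (real p) - of_int (\<alpha> p) / of_int M - of_int h\<bar> < \<epsilon> k / of_int M"
        using t(2)[OF \<open>prime p\<close> \<open>p \<le> k\<close>] by blast
      have "of_int M * t * ln (real p) - of_int (\<alpha> p + M * h)
          = of_int M * (t * ln (real p) - of_int (\<alpha> p) / of_int M - of_int h)"
        using M by (simp add: algebra_simps)
      also have "\<bar>\<dots>\<bar> < \<epsilon> k"
        using h M by (simp add: abs_mult pos_less_divide_eq mult.commute)
      finally show ?thesis by blast
    qed
    moreover have "of_int M * t \<ge> 1 * 1" using M t(1) by (intro mult_mono) auto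
    ultimately show ?thesis by (intro exI[of _ "of_int M * t"]) auto
  qed
  then obtain u where u: "\<And>k. u k \<ge> 1"
      "\<And>k p. prime p \<Longrightarrow> p \<le> k \<Longrightarrow> \<exists>h::int. \<bar>u k * ln (real p) - of_int (\<alpha> p + M * h)\<bar> < \<epsilon> k"
    by metis
  have "\<exists>v\<ge>1. \<forall>p. prime p \<longrightarrow> p \<le> k \<longrightarrow> (\<exists>h::int. \<bar>v * ln (real p) - of_int h\<bar> < \<epsilon> k)" for k
    by (rule approx_ln_primes[OF \<epsilon>[of k], of 1 k "\<lambda>_. 0"]) auto
  then obtain v where v: "\<And>k. v k \<ge> 1"
      "\<And>k p. prime p \<Longrightarrow> p \<le> k \<Longrightarrow> \<exists>h::int. \<bar>v k * ln (real p) - of_int h\<bar> < \<epsilon> k"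
    by metis
  \<comment> \<open>At stage \<open>i\<close> the threshold is the fractional part of \<open>sqrt i\<close>: the steps tend to 0, and
    the value 1 is passed exactly at perfect squares, where the next frequency takes over.\<close>
  define K where "K = (\<lambda>i::nat. nat \<lfloor>sqrt (real i)\<rfloor>)"
  define l where "l = (\<lambda>i. sqrt (real i) - real (K i))"
  \<comment> \<open>Approximation error plus threshold step: exactly the budget in the last
    hypothesis of \<open>mixed_phase_shift\<close>.\<close>
  define \<eta> where "\<eta> = (\<lambda>i. \<epsilon> (K i) + (sqrt (real (Suc i)) - sqrt (real i)))"
  \<comment> \<open>For integers, \<open>i < Suc (K i) ^ 2\<close> gives
    \<open>Suc i \<le> Suc (K i) ^ 2\<close>, so the square root cannot jump past
    \<open>Suc (K i)\<close> and lands on it when its floor increases.\<close>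
  have K_Suc: "K (Suc i) = K i \<or> K (Suc i) = Suc (K i) \<and> sqrt (real (Suc i)) = real (Suc (K i))" for i
  proof -
    have k: "real (K i) \<le> sqrt (real i)" "sqrt (real i) < real (Suc (K i))"
      unfolding K_def by (simp_all, linarith)
    have "real i < (real (Suc (K i)))\<^sup>2"
      using k(2) by (metis of_nat_0_le_iff real_less_lsqrt real_sqrt_less_iff real_sqrt_abs2 abs_of_nat power2_eq_square)
    then have "i < (Suc (K i))\<^sup>2" by (metis of_nat_less_iff of_nat_power)
    then have "real (Suc i) \<le> (real (Suc (K i)))\<^sup>2"
      by (metis Suc_leI of_nat_le_iff of_nat_power)
    then have le: "sqrt (real (Suc i)) \<le> real (Suc (K i))"
      by (intro real_le_lsqrt) auto
    have ge: "real (K i) \<le> sqrt (real (Suc i))"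
      using k(1) by (rule order_trans) simp
    show ?thesis
    proof (cases "sqrt (real (Suc i)) = real (Suc (K i))")
      case True
      have "K (Suc i) = nat \<lfloor>sqrt (real (Suc i))\<rfloor>" by (simp only: K_def)
      also have "\<dots> = Suc (K i)" unfolding True by (simp only: floor_of_nat nat_int)
      finally show ?thesis using True by blast
    next
      case False
      then have "\<lfloor>sqrt (real (Suc i))\<rfloor> = int (K i)"
        using le ge by (intro floor_unique) auto
      then show ?thesis unfolding K_def[THEN fun_cong, of "Suc i"] by simp
    qed
  qed
  have K_lim: "filterlim K at_top sequentially" unfolding K_def by real_asymp
  have \<eta>_ge: "\<epsilon> (K i) < \<eta> i" for i unfolding \<eta>_def by simp
  have "\<epsilon> \<longlonglongrightarrow> 0" unfolding \<epsilon>_def by real_asymp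
  then have "(\<lambda>i. \<epsilon> (K i)) \<longlonglongrightarrow> 0" using K_lim by (rule filterlim_compose)
  moreover have "(\<lambda>i::nat. sqrt (real (Suc i)) - sqrt (real i)) \<longlonglongrightarrow> 0" by real_asymp
  ultimately have "\<eta> \<longlonglongrightarrow> 0 + 0" unfolding \<eta>_def by (rule tendsto_add)
  then have \<eta>_lim: "(\<lambda>i. 800 * \<eta> i) \<longlonglongrightarrow> 0" using tendsto_mult_left[of \<eta> 0 sequentially 800] by simp
  define N where "N = (\<lambda>i a b. {n. near_int (\<eta> i) (a * ln (real n) - b)})"
  \<comment> \<open>The four ways in which \<open>mixed_phase_shift\<close> can fail: a jump of
    either floor, a wrap-around of the selector, a selector near the threshold. Each costs
    \<open>200 * \<eta> i\<close>, hence the 800 in the bound.\<close>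
  define B where "B = (\<lambda>i. (N i (u (K i)) 0 \<union> N i (u (Suc (K i))) 0) \<union> (N i (v (K i)) 0 \<union> N i (v (K i)) (l i)))"
  \<comment> \<open>Ensures that \<open>ln (n + 1) - ln n\<close>, being at most
    \<open>1 / n\<close>, changes each phase in use by less than
    \<open>\<epsilon> (K i)\<close>.\<close>
  define Q where "Q = (\<lambda>i n. 1 \<le> n \<and> (u (K i) + u (Suc (K i)) + v (K i)) * (1 / real n) < \<epsilon> (K i))"
  have Q: "eventually (Q i) sequentially" for i
  proof -
    have "(\<lambda>n. (u (K i) + u (Suc (K i)) + v (K i)) * (1 / real n)) \<longlonglongrightarrow> 0"
      by real_asymp
    then have "\<forall>\<^sub>F n in sequentially. (u (K i) + u (Suc (K i)) + v (K i)) * (1 / real n) < \<epsilon> (K i)"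
      using \<epsilon> by (rule order_tendstoD)
    then show ?thesis unfolding Q_def by (intro eventually_conj eventually_ge_at_top)
  qed
  have B: "\<forall>\<^sub>F x in sequentially. real (count_upto (B i) x) \<le> 800 * \<eta> i * real x" for i
  proof -
    have N: "\<forall>\<^sub>F x in sequentially. real (count_upto (N i a b) x) \<le> 200 * \<eta> i * real x" if "a \<ge> 1" for a b
      unfolding N_def using that \<epsilon>[of "K i"] \<eta>_ge[of i] by (intro count_near_int) auto
    show ?thesis
      using N[OF u(1)[of "K i"], of 0] N[OF u(1)[of "Suc (K i)"], of 0]
        N[OF v(1)[of "K i"], of 0] N[OF v(1)[of "K i"], of "l i"]
    proof eventually_elim
      case (elim x)
      have "count_upto (B i) x \<le> (count_upto (N i (u (K i)) 0) x + count_upto (N i (u (Suc (K i))) 0) x)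
          + (count_upto (N i (v (K i)) 0) x + count_upto (N i (v (K i)) (l i)) x)"
        unfolding B_def by (intro order_trans[OF count_upto_Un_le] add_mono count_upto_Un_le)
      then show ?case using elim by linarith
    qed
  qed
  obtain I where I: "filterlim I at_top sequentially" "\<forall>\<^sub>F n in sequentially. Q (I n) n"
      "\<And>K. \<forall>\<^sub>F n in sequentially. \<forall>m\<in>{n..K * n}. I m = I n \<or> I m = Suc (I n)"
      "\<forall>\<^sub>F n in almost_all. n \<notin> B (I n)"
    using glue_stages[of Q B, OF Q B \<eta>_lim] by blast
  define C where "C = (\<lambda>i y. mixed_phase (v (K i)) (u (K i)) (u (Suc (K i))) (l i) y)"
  define c where "c = (\<lambda>n. C (I n) (ln (real n)))"
  \<comment> \<open>Treats multiplication by \<open>p\<close>, with \<open>d = ln p\<close>, and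
    passage to the successor, with \<open>a = 0\<close> and tiny \<open>d\<close>, at once.\<close>
  have shift: "[c m = c n + a] (mod M)"
    if "n \<notin> B (I n)" "I m = I n \<or> I m = Suc (I n)"
      "\<bar>u (K (I n)) * d - of_int (a + M * h)\<bar> < \<epsilon> (K (I n))"
      "\<bar>u (Suc (K (I n))) * d - of_int (a + M * h')\<bar> < \<epsilon> (K (I n))"
      "\<bar>v (K (I n)) * d - of_int h''\<bar> < \<epsilon> (K (I n))"
      "ln (real m) = ln (real n) + d" for m n a d h h' h''
  proof -
    define i where "i = I n"
    define k where "k = K i"
    have *: "[mixed_phase (v k) (u k) (u (Suc k)) l' (ln (real m)) = c n + a] (mod M)"
      if "l i \<le> l'" "l' - l i + \<epsilon> k \<le> \<eta> i" for l'
      unfolding c_def C_def i_def[symmetric] k_def[symmetric] \<open>ln (real m) = ln (real n) + d\<close>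
      by (rule mixed_phase_shift[where e = "\<epsilon> k" and \<eta> = "\<eta> i" and h = h and h' = h' and h'' = h''])
         (use \<open>n \<notin> B (I n)\<close> that in \<open>simp_all add: i_def[symmetric] k_def[symmetric]\<close>,
          use \<open>n \<notin> B (I n)\<close> \<open>\<bar>u (K (I n)) * d - of_int (a + M * h)\<bar> < \<epsilon> (K (I n))\<close>
            \<open>\<bar>u (Suc (K (I n))) * d - of_int (a + M * h')\<bar> < \<epsilon> (K (I n))\<close>
            \<open>\<bar>v (K (I n)) * d - of_int h''\<bar> < \<epsilon> (K (I n))\<close>
          in \<open>auto simp: B_def N_def i_def k_def\<close>)
    consider "I m = i" | "I m = Suc i" "K (Suc i) = k" |
        "I m = Suc i" "K (Suc i) = Suc k" "sqrt (real (Suc i)) = real (Suc k)"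
      using \<open>I m = I n \<or> I m = Suc (I n)\<close> K_Suc[of i] unfolding i_def k_def by blast
    then show ?thesis
    proof cases
      case 1
      then have "c m = mixed_phase (v k) (u k) (u (Suc k)) (l i) (ln (real m))"
        by (simp add: c_def C_def k_def)
      then show ?thesis using *[of "l i"] \<eta>_ge[of i] by (simp add: k_def)
    next
      case 2
      then have "c m = mixed_phase (v k) (u k) (u (Suc k)) (l (Suc i)) (ln (real m))"
        by (simp add: c_def C_def)
      moreover have "l (Suc i) - l i = sqrt (real (Suc i)) - sqrt (real i)"
        using 2(2) by (simp add: l_def k_def)
      moreover have "sqrt (real i) \<le> sqrt (real (Suc i))" by simp
      ultimately have "l i \<le> l (Suc i)" "l (Suc i) - l i + \<epsilon> k \<le> \<eta> i" "c m = mixed_phase (v k) (u k) (u (Suc k)) (l (Suc i)) (ln (real m))"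
        unfolding \<eta>_def k_def[symmetric] by linarith+
      then show ?thesis using *[of "l (Suc i)"] by simp
    next
      \<comment> \<open>At a perfect square \<open>l (Suc i) = 0\<close>, so the new mixture is the
        pure frequency \<open>u (Suc k)\<close>, which is the old mixture with threshold 1; the
        change of \<open>v\<close> is then invisible.\<close>
      case 3
      then have "c m = mixed_phase (v k) (u k) (u (Suc k)) 1 (ln (real m))"
        by (simp add: c_def C_def l_def)
      moreover have "1 - l i = sqrt (real (Suc i)) - sqrt (real i)"
        using 3(3) by (simp add: l_def k_def)
      moreover have "sqrt (real i) \<le> sqrt (real (Suc i))" by simp
      ultimately have "l i \<le> 1" "1 - l i + \<epsilon> k \<le> \<eta> i" "c m = mixed_phase (v k) (u k) (u (Suc k)) 1 (ln (real m))"
        unfolding \<eta>_def k_def[symmetric] by linarith+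
      then show ?thesis using *[of 1] by simp
    qed
  qed
  have \<epsilon>_Suc: "\<epsilon> (Suc k) \<le> \<epsilon> k" for k
    by (simp add: \<epsilon>_def frac_le)
  show ?thesis
  proof (rule that[of c])
    fix p :: nat assume p: "prime p"
    \<comment> \<open>A fixed prime is eventually among those to which the frequencies are
      tuned.\<close>
    have "\<forall>\<^sub>F n in sequentially. p \<le> K (I n)"
      using filterlim_compose[OF K_lim I(1)] by (simp add: filterlim_at_top)
    then have "\<forall>\<^sub>F n in sequentially. p \<le> K (I n) \<and> 1 \<le> n \<and> (\<forall>m\<in>{n..p * n}. I m = I n \<or> I m = Suc (I n))"
      by (intro eventually_conj I(3) eventually_ge_at_top)
    from eventually_conj[OF I(4) eventually_almost_all_sequentially[OF this]]
    show "\<forall>\<^sub>F n in almost_all. [c (p * n) = c n + \<alpha> p] (mod M)"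
    proof eventually_elim
      case (elim n)
      let ?k = "K (I n)"
      have p0: "p > 0" using p by (rule prime_gt_0_nat)
      obtain h :: int where h: "\<bar>u ?k * ln (real p) - of_int (\<alpha> p + M * h)\<bar> < \<epsilon> ?k"
        using u(2)[OF p] elim by blast
      obtain h' :: int where h': "\<bar>u (Suc ?k) * ln (real p) - of_int (\<alpha> p + M * h')\<bar> < \<epsilon> (Suc ?k)"
        using u(2)[OF p, of "Suc ?k"] elim by auto
      obtain h'' :: int where h'': "\<bar>v ?k * ln (real p) - of_int h''\<bar> < \<epsilon> ?k"
        using v(2)[OF p] elim by blast
      have h'_le: "\<bar>u (Suc ?k) * ln (real p) - of_int (\<alpha> p + M * h')\<bar> < \<epsilon> ?k"
        using h' \<epsilon>_Suc by (rule less_le_trans)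
      have "p * n \<in> {n..p * n}" using p0 by simp
      then have I_p: "I (p * n) = I n \<or> I (p * n) = Suc (I n)" using elim by blast
      have "ln (real (p * n)) = ln (real n) + ln (real p)"
        using p0 elim by (simp add: ln_mult)
      from shift[OF conjunct1[OF elim] I_p h h'_le h'' this] show ?case .
    qed
  next
    have "\<forall>\<^sub>F n in sequentially. Q (I n) n \<and> (\<forall>m\<in>{n..2 * n}. I m = I n \<or> I m = Suc (I n))"
      by (intro eventually_conj I(2,3))
    from eventually_conj[OF I(4) eventually_almost_all_sequentially[OF this]]
    show "\<forall>\<^sub>F n in almost_all. [c (Suc n) = c n] (mod M)"
    proof eventually_elim
      case (elim n)
      let ?k = "K (I n)"
      define d where "d = ln (real (Suc n)) - ln (real n)"
      have n: "n \<ge> 1" using elim by (simp add: Q_def)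
      have "d = ln (1 + 1 / real n)"
      proof -
        have "1 + 1 / real n = real (Suc n) / real n" using n by (simp add: field_simps)
        then show ?thesis using n by (simp add: d_def ln_div)
      qed
      then have d: "0 \<le> d" "d \<le> 1 / real n"
        using n ln_add_one_self_le_self[of "1 / real n"] by auto
      have sum: "(u ?k + u (Suc ?k) + v ?k) * (1 / real n) < \<epsilon> ?k"
        using elim by (simp add: Q_def)
      have small: "\<bar>w * d\<bar> < \<epsilon> ?k" if "0 \<le> w" "w \<le> u ?k + u (Suc ?k) + v ?k" for w
      proof -
        have "\<bar>w * d\<bar> = w * d" using that d by simp
        also have "\<dots> \<le> (u ?k + u (Suc ?k) + v ?k) * (1 / real n)"
          using that d by (intro mult_mono) auto
        finally show ?thesis using sum by linarith
      qed
      have "Suc n \<in> {n..2 * n}" using n by simp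
      then have I_Suc: "I (Suc n) = I n \<or> I (Suc n) = Suc (I n)" using elim by blast
      have "n \<notin> B (I n)" using elim by blast
      moreover note I_Suc
      moreover have "\<bar>u ?k * d - of_int (0 + M * 0)\<bar> < \<epsilon> ?k" "\<bar>u (Suc ?k) * d - of_int (0 + M * 0)\<bar> < \<epsilon> ?k"
          "\<bar>v ?k * d - of_int 0\<bar> < \<epsilon> ?k"
        using small[of "u ?k"] small[of "u (Suc ?k)"] small[of "v ?k"]
          u(1)[of ?k] u(1)[of "Suc ?k"] v(1)[of ?k] by simp_all
      moreover have "ln (real (Suc n)) = ln (real n) + d" by (simp add: d_def)
      ultimately have "[c (Suc n) = c n + 0] (mod M)" by (rule shift)
      then show ?case by simp
    qed
  qed
qed

section \<open>From phases to the stable set\<close>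

text \<open>Raising a primitive root to the slow phase turns addition of discrete logarithms modulo
  \<open>q - 1\<close> into multiplication modulo \<open>q\<close>. The prime \<open>q\<close> has
  no discrete logarithm and receives the phase increment 0.\<close>

lemma exists_slow_character:
  fixes q :: nat
  assumes q: "prime q"
  obtains a :: "nat \<Rightarrow> nat"
  where "\<And>n. coprime (a n) q"
    and "\<And>p. prime p \<Longrightarrow> p \<noteq> q \<Longrightarrow> \<forall>\<^sub>F n in almost_all. [a (p * n) = p * a n] (mod q)"
    and "\<forall>\<^sub>F n in almost_all. [a (q * n) = a n] (mod q)"
    and "\<forall>\<^sub>F n in almost_all. [a (Suc n) = a n] (mod q)"
proof -
  have q1: "q > 1" using q by (rule prime_gt_1_nat)
  obtain g where g: "residue_primroot q g" using prime_primitive_root_exists[OF q1 q] by blast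
  then have cop: "coprime q g" and ord: "ord q g = q - 1"
    using q by (auto simp: residue_primroot_def totient_prime)
  have "\<exists>k. [g ^ k = p] (mod q)" if "\<not> q dvd p" for p
  proof -
    have "p mod q \<in> totatives q"
      using q1 that prime_imp_coprime[OF q that]
      by (auto simp: totatives_def mod_greater_zero_iff_not_dvd coprime_commute)
    then have "p mod q \<in> (\<lambda>i. g ^ i mod q) ` {..<totient q}"
      using residue_primroot_is_generator[OF q1 g] by (simp add: bij_betw_def)
    then show ?thesis by (auto simp: cong_def)
  qed
  then obtain dlog where dlog: "\<And>p. \<not> q dvd p \<Longrightarrow> [g ^ dlog p = p] (mod q)" by metis
  obtain c where c: "\<And>p. prime p \<Longrightarrow> \<forall>\<^sub>F n in almost_all.
        [c (p * n) = c n + (if p = q then 0 else int (dlog p))] (mod int (q - 1))"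
      "\<forall>\<^sub>F n in almost_all. [c (Suc n) = c n] (mod int (q - 1))"
    using exists_slow_phase[of "int (q - 1)" "\<lambda>p. if p = q then 0 else int (dlog p)"] q1 by auto
  \<comment> \<open>Since \<open>c n\<close> may be negative, its representative modulo the order
    \<open>q - 1\<close> of \<open>g\<close> serves as the exponent.\<close>
  define a where "a = (\<lambda>n. g ^ nat (c n mod int (q - 1)))"
  have shift: "[a m = g ^ k * a n] (mod q)" if "[c m = c n + int k] (mod int (q - 1))" for m n k
  proof -
    have "[int (nat (c m mod int (q - 1))) = int (k + nat (c n mod int (q - 1)))] (mod int (q - 1))"
      using that q1 by (simp add: cong_def mod_add_right_eq add.commute)
    then have "[nat (c m mod int (q - 1)) = k + nat (c n mod int (q - 1))] (mod ord q g)"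
      unfolding ord by (simp only: cong_int_iff)
    then show ?thesis
      unfolding a_def power_add[symmetric] using order_divides_expdiff[OF cop] by blast
  qed
  show ?thesis
  proof (rule that[of a])
    show "coprime (a n) q" for n using cop by (simp add: a_def coprime_commute)
  next
    fix p assume p: "prime p" "p \<noteq> q"
    then have "\<not> q dvd p" using q primes_dvd_imp_eq by blast
    then have "[g ^ dlog p * a n = p * a n] (mod q)" for n
      by (intro cong_mult dlog cong_refl)
    note cancel = this
    show "\<forall>\<^sub>F n in almost_all. [a (p * n) = p * a n] (mod q)"
      using c(1)[OF p(1)]
    proof eventually_elim
      case (elim n)
      then have "[a (p * n) = g ^ dlog p * a n] (mod q)" using p(2) by (intro shift) simp
      then show ?case using cancel by (rule cong_trans)
    qed
  next
    show "\<forall>\<^sub>F n in almost_all. [a (q * n) = a n] (mod q)"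
      using c(1)[OF q] by eventually_elim (use shift[of _ _ 0] in auto)
    show "\<forall>\<^sub>F n in almost_all. [a (Suc n) = a n] (mod q)"
      using c(2) by eventually_elim (use shift[of _ _ 0] in auto)
  qed
qed

text \<open>Constancy on the blocks \<open>[q m, q m + q)\<close> makes the density count exact.\<close>

lemma exists_block_character:
  fixes q :: nat
  assumes q: "prime q"
  obtains b :: "nat \<Rightarrow> nat"
  where "\<And>n. coprime (b n) q"
    and "\<And>n. b n = b (q * (n div q))"
    and "\<And>p. prime p \<Longrightarrow> p \<noteq> q \<Longrightarrow> \<forall>\<^sub>F n in almost_all. [b (p * n) = p * b n] (mod q)"
    and "\<forall>\<^sub>F n in almost_all. [b (q * n) = b n] (mod q)"
    and "\<forall>\<^sub>F n in almost_all. [b (Suc n) = b n] (mod q)"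
proof -
  obtain a :: "nat \<Rightarrow> nat" where a: "\<And>n. coprime (a n) q"
      "\<And>p. prime p \<Longrightarrow> p \<noteq> q \<Longrightarrow> \<forall>\<^sub>F n in almost_all. [a (p * n) = p * a n] (mod q)"
      "\<forall>\<^sub>F n in almost_all. [a (q * n) = a n] (mod q)"
      "\<forall>\<^sub>F n in almost_all. [a (Suc n) = a n] (mod q)"
    using exists_slow_character[OF q] by blast
  have q0: "q > 0" using q by (rule prime_gt_0_nat)
  define b where "b = (\<lambda>n. a (q * (n div q)))"
  \<comment> \<open>The start of the block of \<open>n\<close> lies \<open>n mod q\<close> steps
    back, so constancy across at most \<open>q\<close> preceding steps links \<open>b n\<close> to
    \<open>a n\<close>.\<close>
  have "\<forall>\<^sub>F n in almost_all. \<forall>i\<in>{..q}. [a (Suc (n - i)) = a (n - i)] (mod q)"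
    by (intro eventually_ball_finite ballI eventually_almost_all_diff[OF a(4)]) auto
  moreover have "\<forall>\<^sub>F n in almost_all. n \<ge> q"
    by (rule eventually_almost_all_sequentially) (rule eventually_ge_at_top)
  ultimately have ba: "\<forall>\<^sub>F n in almost_all. [b n = a n] (mod q)"
  proof eventually_elim
    case (elim n)
    have "[a (n - j) = a n] (mod q)" if "j \<le> q" for j
      using that
    proof (induction j)
      case (Suc j)
      have "Suc (n - Suc j) = n - j" using Suc.prems elim(2) by simp
      then have "[a (n - j) = a (n - Suc j)] (mod q)" using elim(1)[rule_format, of "Suc j"] Suc.prems by simp
      then have "[a (n - Suc j) = a (n - j)] (mod q)" by (rule cong_sym)
      also have "[a (n - j) = a n] (mod q)" using Suc by simp
      finally show ?case .
    qed simp
    moreover have "n mod q \<le> q" using q0 by (simp add: less_imp_le)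
    ultimately have "[a (n - n mod q) = a n] (mod q)" by blast
    then show ?case by (simp add: b_def minus_mod_eq_mult_div)
  qed
  show ?thesis
  proof (rule that[of b])
    show "coprime (b n) q" "b n = b (q * (n div q))" for n
      using a(1) q0 by (simp_all add: b_def)
  next
    fix p assume p: "prime p" "p \<noteq> q"
    show "\<forall>\<^sub>F n in almost_all. [b (p * n) = p * b n] (mod q)"
      using a(2)[OF p] ba eventually_almost_all_mult[OF ba prime_gt_0_nat[OF p(1)]]
    proof eventually_elim
      case (elim n)
      have "[b (p * n) = p * a n] (mod q)" using elim(3,1) by (rule cong_trans)
      also have "[p * a n = p * b n] (mod q)" using elim(2) by (rule cong_mult[OF cong_refl cong_sym])
      finally show ?case .
    qed
  next
    show "\<forall>\<^sub>F n in almost_all. [b (q * n) = b n] (mod q)"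
      using a(3) ba eventually_almost_all_mult[OF ba q0]
      by eventually_elim (simp add: cong_def)
    show "\<forall>\<^sub>F n in almost_all. [b (Suc n) = b n] (mod q)"
      using a(4) ba eventually_almost_all_shift[OF ba, of 1]
      unfolding Suc_eq_plus1
      by eventually_elim (simp add: cong_def)
  qed
qed

section \<open>Transfer of densities and self-similar counts\<close>

lemma count_density_cong:
  assumes "\<forall>\<^sub>F n in almost_all. n \<in> A \<longleftrightarrow> n \<in> B" and "(\<lambda>x. real (count_upto A x) / real x) \<longlonglongrightarrow> d"
  shows "(\<lambda>x. real (count_upto B x) / real x) \<longlonglongrightarrow> d"
proof -
  let ?D = "{n. \<not> (n \<in> A \<longleftrightarrow> n \<in> B)}"
  have le: "count_upto A x \<le> count_upto B x + count_upto ?D x" "count_upto B x \<le> count_upto A x + count_upto ?D x" for x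
    by (rule order_trans[OF count_upto_mono count_upto_Un_le], auto)+
  have bd: "\<bar>real (count_upto B x) / real x - real (count_upto A x) / real x\<bar> \<le> real (count_upto ?D x) / real x" for x
    unfolding diff_divide_distrib[symmetric] abs_divide abs_of_nat
  proof (intro divide_right_mono)
    fix x
    have "real (count_upto A x) \<le> real (count_upto B x) + real (count_upto ?D x)"
      "real (count_upto B x) \<le> real (count_upto A x) + real (count_upto ?D x)"
      using le[of x] by linarith+
    then show "\<bar>real (count_upto B x) - real (count_upto A x)\<bar> \<le> real (count_upto ?D x)" by linarith
  qed simp
  have D: "(\<lambda>x. real (count_upto ?D x) / real x) \<longlonglongrightarrow> 0"
    using assms(1) unfolding eventually_almost_all .
  have "(\<lambda>x. real (count_upto B x) / real x - real (count_upto A x) / real x) \<longlonglongrightarrow> 0"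
    by (rule Lim_null_comparison[OF _ D]) (simp only: real_norm_def bd eventually_True)
  from tendsto_add[OF this assms(2)] show ?thesis by simp
qed

text \<open>\<open>E (x div q) + x div q\<close> splits a set \<open>E\<close> into its multiples of \<open>q\<close>, which repeat \<open>E\<close>
  at a smaller scale, and one element per block; iterating sums the geometric series \<open>1 / (q - 1)\<close>.\<close>

lemma density_of_self_similar_count:
  fixes E D :: "nat \<Rightarrow> nat" and q :: nat
  assumes q: "q \<ge> 2" and E: "\<And>x. E x \<le> x"
    and rec: "\<And>x. \<bar>real (E x) - real (E (x div q)) - real (x div q)\<bar> \<le> 1 + real (D x)"
    and D: "(\<lambda>x. real (D x) / real x) \<longlonglongrightarrow> 0"
  shows "(\<lambda>x. real (E x) / real x) \<longlonglongrightarrow> 1 / (real q - 1)"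
proof -
  \<comment> \<open>\<open>x / (q - 1)\<close> solves the recursion up to a bounded remainder, so
    \<open>F\<close> is the deviation to be shown \<open>o(x)\<close>.\<close>
  define F where "F = (\<lambda>x. real (E x) - real x / (real q - 1))"
  have step: "\<bar>F x\<bar> \<le> \<bar>F (x div q)\<bar> + (2 + real (D x))" for x
  proof -
    have "real x = real q * real (x div q) + real (x mod q)"
      unfolding of_nat_mult[symmetric] of_nat_add[symmetric] by simp
    then have "real x - real (x div q) = (real q - 1) * real (x div q) + real (x mod q)"
      by (simp add: algebra_simps)
    then have "real x / (real q - 1) - real (x div q) / (real q - 1) = real (x div q) + real (x mod q) / (real q - 1)"
      using q by (simp add: diff_divide_distrib[symmetric] add_divide_distrib)
    moreover have "x mod q \<le> q - 1" using q mod_less_divisor[of q x] by linarith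
    then have "real (x mod q) / (real q - 1) \<le> 1" "0 \<le> real (x mod q) / (real q - 1)"
      using q by (auto simp: divide_le_eq)
    ultimately show ?thesis using rec[of x] unfolding F_def by linarith
  qed
  have F_le: "\<bar>F x\<bar> \<le> real x" for x
  proof -
    have "real x / (real q - 1) \<le> real x" "0 \<le> real x / (real q - 1)"
      using q mult_left_mono[of 1 "real q - 1" "real x"] by (auto simp: divide_le_eq)
    then show ?thesis using E[of x] unfolding F_def by simp
  qed
  have "(\<lambda>x. F x / real x) \<longlonglongrightarrow> 0"
  proof (rule tendstoI)
    fix e :: real assume e: "e > 0"
    define e' where "e' = e / 2"
    have e': "e' > 0" using e by (simp add: e'_def)
    have "(\<lambda>x::nat. 2 / real x + real (D x) / real x) \<longlonglongrightarrow> 0 + 0"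
      by (intro tendsto_add D) real_asymp
    then have "\<forall>\<^sub>F x in sequentially. 2 / real x + real (D x) / real x < e' / 2"
      using e' by (intro order_tendstoD) auto
    then have "\<forall>\<^sub>F x in sequentially. 2 + real (D x) \<le> e' / 2 * real x"
      using eventually_gt_at_top[of 0]
      by eventually_elim (simp add: add_divide_distrib[symmetric] divide_less_eq)
    then obtain X where X: "\<And>x. x \<ge> X \<Longrightarrow> 2 + real (D x) \<le> e' / 2 * real x"
      by (auto simp: eventually_sequentially)
    \<comment> \<open>The induction closes because \<open>x div q \<le> x / 2\<close>: half of
      \<open>e' * x\<close> comes from the smaller scale and half from the new error, while
      \<open>Suc X\<close> covers the start.\<close>
    have bound: "\<bar>F x\<bar> \<le> e' * real x + real (Suc X)" for x
    proof (induction x rule: less_induct)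
      case (less x)
      show ?case
      proof (cases "x \<le> Suc X")
        case True
        have "0 \<le> e' * real x" using e' by simp
        then show ?thesis using F_le[of x] True by (simp add: add_increasing)
      next
        case False
        have "\<bar>F (x div q)\<bar> \<le> e' * real (x div q) + real (Suc X)"
          using False q by (intro less) simp
        also have "real (x div q) \<le> real x / 2"
        proof -
          have "real (x div q) \<le> real (x div 2)" using q by (intro of_nat_mono div_le_mono2) auto
          also have "\<dots> \<le> real x / 2" by linarith
          finally show ?thesis .
        qed
        finally have "\<bar>F (x div q)\<bar> \<le> e' * (real x / 2) + real (Suc X)" using e' by simp
        moreover have "2 + real (D x) \<le> e' / 2 * real x" using False by (intro X) simp
        moreover have "e' * (real x / 2) + e' / 2 * real x = e' * real x" by simp
        ultimately show ?thesis using step[of x] by linarith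
      qed
    qed
    have "\<forall>\<^sub>F x in sequentially. e' * real x + real (Suc X) < e * real x"
      unfolding e'_def using e by real_asymp
    then show "\<forall>\<^sub>F x in sequentially. dist (F x / real x) 0 < e"
      using eventually_gt_at_top[of 0]
    proof eventually_elim
      case (elim x)
      then have "\<bar>F x\<bar> < e * real x" using bound[of x] by linarith
      then show ?case using elim by (simp add: divide_less_eq)
    qed
  qed
  then have "(\<lambda>x. F x / real x + 1 / (real q - 1)) \<longlonglongrightarrow> 0 + 1 / (real q - 1)"
    by (intro tendsto_add tendsto_const)
  moreover have "\<forall>\<^sub>F x in sequentially. F x / real x + 1 / (real q - 1) = real (E x) / real x"
    using eventually_gt_at_top[of 0]
  proof eventually_elim
    case (elim x)
    then show ?case using q by (simp add: F_def diff_divide_distrib)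
  qed
  ultimately show ?thesis unfolding add_0_left by (rule Lim_transform_eventually)
qed

section \<open>The part of an integer prime to \<open>q\<close>\<close>

definition prime_free_part :: "nat \<Rightarrow> nat \<Rightarrow> nat" where
  "prime_free_part q n = n div q ^ multiplicity q n"

lemma prime_free_part_not_dvd:
  assumes "\<not> q dvd n" shows "prime_free_part q n = n"
  unfolding prime_free_part_def not_dvd_imp_multiplicity_0[OF assms] by simp

lemma not_dvd_prime_free_part:
  assumes "prime q" "n > 0" shows "\<not> q dvd prime_free_part q n"
proof -
  have "\<not> is_unit q" using assms(1) prime_gt_1_nat[of q] by simp
  with assms(2) show ?thesis
    unfolding prime_free_part_def by (intro multiplicity_decompose) simp_all
qed

lemma prime_free_part_mult_self:
  assumes "prime q" "n > 0" shows "prime_free_part q (q * n) = prime_free_part q n"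
proof -
  have "q \<noteq> 0" "\<not> is_unit q" using prime_gt_1_nat[OF assms(1)] by auto
  with assms(2) have "multiplicity q (q * n) = Suc (multiplicity q n)"
    by (intro multiplicity_times_same) simp_all
  then show ?thesis using \<open>q \<noteq> 0\<close> unfolding prime_free_part_def by simp
qed

lemma prime_free_part_mult_other:
  assumes "prime q" "\<not> q dvd p" "n > 0" shows "prime_free_part q (p * n) = p * prime_free_part q n"
proof -
  have "p > 0" using assms(2) by (intro gr0I) simp
  then have "multiplicity q (p * n) = multiplicity q n"
    using assms prime_elem_multiplicity_mult_distrib[of q p n] by (simp add: not_dvd_imp_multiplicity_0)
  then show ?thesis
    by (simp add: prime_free_part_def div_mult_swap multiplicity_dvd)
qed

section \<open>Assembly of the stable set\<close>

theorem theorem1p7: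
  fixes q :: nat
  assumes "prime q"
  shows "\<exists>S::nat set. S \<subseteq> {1..} \<and> stable_set S
           \<and> has_natural_density S (1 - 1 / (real q - 1))
           \<and> (\<Inter>h\<in>{0..int q - 1}. shift_set S h) = {}"
proof -
  note q = assms
  have q1: "q > 1" using q by (rule prime_gt_1_nat)
  obtain b :: "nat \<Rightarrow> nat" where cop: "\<And>n. coprime (b n) q"
    and block: "\<And>n. b n = b (q * (n div q))"
    and b_mult: "\<And>p. prime p \<Longrightarrow> p \<noteq> q \<Longrightarrow> \<forall>\<^sub>F n in almost_all. [b (p * n) = p * b n] (mod q)"
    and b_q: "\<forall>\<^sub>F n in almost_all. [b (q * n) = b n] (mod q)"
    and b_Suc: "\<forall>\<^sub>F n in almost_all. [b (Suc n) = b n] (mod q)"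
    using exists_block_character[OF q] by blast
  \<comment> \<open>The residue prescribed by \<open>b\<close> is never 0, so the number it marks in
    a block is prime to \<open>q\<close>.\<close>
  have b_ndvd: "\<not> q dvd b n" for n
    using cop[of n] q1 by (metis coprime_absorb_right nat_neq_iff dvd_1_iff_1 One_nat_def)
  have pos: "\<forall>\<^sub>F n in almost_all. n > 0"
    by (rule eventually_almost_all_sequentially) (rule eventually_gt_at_top)
  define T where "T = {n. [prime_free_part q n = b n] (mod q)}"
  have T_nd: "n \<in> T \<longleftrightarrow> n mod q = b n mod q" if "\<not> q dvd n" for n
    using that by (simp add: T_def prime_free_part_not_dvd cong_def)

  \<comment> \<open>For almost all \<open>n\<close>, passing to \<open>q * n\<close> changes neither
    the part prime to \<open>q\<close> nor \<open>b\<close> modulo \<open>q\<close>; for other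
    \<open>p\<close> both acquire the factor \<open>p\<close>, which cancels.\<close>
  have T_stable: "\<forall>\<^sub>F n in almost_all. p * n \<in> T \<longleftrightarrow> n \<in> T" if p: "prime p" for p
  proof (cases "p = q")
    case True
    show ?thesis using b_q pos
    proof eventually_elim
      case (elim n)
      then show ?case using True q
        by (auto simp: T_def prime_free_part_mult_self cong_def)
    qed
  next
    case False
    then have ndvd: "\<not> q dvd p" using p q primes_dvd_imp_eq by blast
    then have "coprime p q" using q by (meson coprime_commute prime_imp_coprime)
    show ?thesis using b_mult[OF p False] pos
    proof eventually_elim
      case (elim n)
      have "p * n \<in> T \<longleftrightarrow> [p * prime_free_part q n = p * b n] (mod q)"
        using elim by (auto simp: T_def prime_free_part_mult_other[OF q ndvd] cong_def)
      also have "\<dots> \<longleftrightarrow> n \<in> T"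
        using \<open>coprime p q\<close> by (simp add: T_def cong_mult_lcancel_nat)
      finally show ?case .
    qed
  qed

  define D where "D = count_upto {m. \<not> (q * m \<in> T \<longleftrightarrow> m \<in> T)}"
  have "(\<lambda>x. real (count_upto T x) / real x) \<longlonglongrightarrow> 1 / (real q - 1)"
  proof (rule density_of_self_similar_count[where D = D])
    fix x
    \<comment> \<open>As \<open>b\<close> is constant on the block from \<open>q * j\<close> to
      \<open>q * j + q - 1\<close>, the only member of \<open>T\<close> there that is prime to
      \<open>q\<close> is \<open>?f j\<close>.\<close>
    let ?f = "\<lambda>j. q * j + b (q * j) mod q"
    have inj: "inj_on ?f A" for A
    proof (rule inj_onI)
      fix i j assume "?f i = ?f j"
      then have "?f i div q = ?f j div q" by simp
      then show "i = j" using q1 by simp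
    qed
    have nd_iff: "n \<in> T \<and> \<not> q dvd n \<longleftrightarrow> n \<in> range ?f" for n
    proof
      assume n: "n \<in> T \<and> \<not> q dvd n"
      then have "n mod q = b (q * (n div q)) mod q" using T_nd block by metis
      then have "n = ?f (n div q)" by (metis mult_div_mod_eq)
      then show "n \<in> range ?f" by blast
    next
      assume "n \<in> range ?f"
      then obtain j where j: "n = ?f j" by blast
      then have m: "n mod q = b (q * j) mod q" and "n div q = j" using q1 by simp_all
      then have "n mod q = b n mod q" using block[of n] by simp
      moreover have "\<not> q dvd n" using m b_ndvd[of "q * j"] by (simp add: dvd_eq_mod_eq_0)
      ultimately show "n \<in> T \<and> \<not> q dvd n" using T_nd by blast
    qed
    define X where "X = x div q"
    \<comment> \<open>The \<open>X\<close> complete blocks give one element each and the last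
      partial block at most one more.\<close>
    define U where "U = {n \<in> T. \<not> q dvd n} \<inter> {1..x}"
    have "?f ` {..<X} \<subseteq> U"
    proof
      fix n assume "n \<in> ?f ` {..<X}"
      then obtain j where j: "j < X" "n = ?f j" by blast
      then have n: "n \<in> T" "\<not> q dvd n" using nd_iff by blast+
      have "n \<le> q * j + q" using j q1 by (simp add: less_imp_le)
      also have "\<dots> = q * Suc j" by simp
      also have "\<dots> \<le> q * X" using j by (intro mult_left_mono) auto
      also have "\<dots> \<le> x" by (simp add: X_def)
      finally have "n \<le> x" .
      moreover have "n \<ge> 1" using n(2) by (cases n) auto
      ultimately show "n \<in> U" using n by (simp add: U_def)
    qed
    then have "card (?f ` {..<X}) \<le> card U" by (intro card_mono) (auto simp: U_def)
    then have U1: "X \<le> card U" by (simp add: card_image[OF inj])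
    have "U \<subseteq> ?f ` {..X}"
    proof
      fix n assume n: "n \<in> U"
      then obtain j where j: "n = ?f j" using nd_iff unfolding U_def by blast
      then have "j = n div q" using q1 by simp
      also have "\<dots> \<le> X" using n by (auto simp: U_def X_def intro: div_le_mono)
      finally show "n \<in> ?f ` {..X}" using j by blast
    qed
    then have "card U \<le> card (?f ` {..X})" by (intro card_mono) auto
    then have U2: "card U \<le> Suc X" by (simp add: card_image[OF inj])
    \<comment> \<open>Multiples of \<open>q\<close> in \<open>T\<close> up to \<open>x\<close>
      correspond to \<open>V\<close> up to \<open>X\<close>, and the counts of \<open>V\<close> and
      \<open>T\<close> differ by at most \<open>D\<close>.\<close>
    define V where "V = {m. q * m \<in> T}"
    have "T \<inter> {1..x} = U \<union> (\<lambda>m. q * m) ` (V \<inter> {1..X})"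
    proof (intro equalityI subsetI)
      fix n assume n: "n \<in> T \<inter> {1..x}"
      show "n \<in> U \<union> (\<lambda>m. q * m) ` (V \<inter> {1..X})"
      proof (cases "q dvd n")
        case True
        then obtain m where m: "n = q * m" by blast
        have "m \<in> V \<inter> {1..X}"
          using n m q1 by (auto simp: V_def X_def less_eq_div_iff_mult_less_eq mult.commute Suc_le_eq)
        then show ?thesis using m by blast
      qed (use n in \<open>auto simp: U_def\<close>)
    next
      fix n assume "n \<in> U \<union> (\<lambda>m. q * m) ` (V \<inter> {1..X})"
      then show "n \<in> T \<inter> {1..x}"
        using q1 by (auto simp: U_def V_def X_def less_eq_div_iff_mult_less_eq mult.commute Suc_le_eq)
    qed
    moreover have "U \<inter> (\<lambda>m. q * m) ` (V \<inter> {1..X}) = {}" by (auto simp: U_def)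
    ultimately have "count_upto T x = card U + card ((\<lambda>m. q * m) ` (V \<inter> {1..X}))"
      unfolding count_upto_def by (simp add: card_Un_disjoint U_def)
    also have "card ((\<lambda>m. q * m) ` (V \<inter> {1..X})) = count_upto V X"
      unfolding count_upto_def using q1 by (intro card_image) (auto simp: inj_on_def)
    finally have T_eq: "count_upto T x = card U + count_upto V X" .
    have "count_upto V X \<le> count_upto T X + D X" "count_upto T X \<le> count_upto V X + D X"
      unfolding D_def by (rule order_trans[OF count_upto_mono count_upto_Un_le], auto simp: V_def)+
    moreover have "D X \<le> D x"
      unfolding D_def count_upto_def X_def
      by (intro card_mono) (auto intro: order_trans[OF _ div_le_dividend])
    ultimately show "\<bar>real (count_upto T x) - real (count_upto T (x div q)) - real (x div q)\<bar> \<le> 1 + real (D x)"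
      using T_eq U1 U2 unfolding X_def[symmetric] by linarith
  next
    show "(\<lambda>x. real (D x) / real x) \<longlonglongrightarrow> 0"
      using T_stable[OF q] unfolding eventually_almost_all D_def .
  qed (use q1 count_upto_le in auto)
  then have "(\<lambda>x. 1 - real (count_upto T x) / real x) \<longlonglongrightarrow> 1 - 1 / (real q - 1)"
    by (intro tendsto_diff tendsto_const)
  moreover have "\<forall>\<^sub>F x in sequentially.
      1 - real (count_upto T x) / real x = real (count_upto (- T) x) / real x"
    using eventually_gt_at_top[of 0]
  proof eventually_elim
    case (elim x)
    have "(- T) \<inter> {1..x} = {1..x} - T \<inter> {1..x}" by auto
    then have "count_upto (- T) x = x - count_upto T x"
      unfolding count_upto_def by (simp add: card_Diff_subset)
    then show ?case using elim count_upto_le[of T x] by (simp add: of_nat_diff diff_divide_distrib)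
  qed
  ultimately have compl_density: "(\<lambda>x. real (count_upto (- T) x) / real x) \<longlonglongrightarrow> 1 - 1 / (real q - 1)"
    by (rule Lim_transform_eventually)

  define W where "W = {n. \<forall>i<q. n + i \<notin> T}"
  have W: "\<forall>\<^sub>F n in almost_all. n \<notin> W"
  proof -
    have "\<forall>\<^sub>F n in almost_all. \<forall>j\<in>{..<q}. [b (Suc (n + j)) = b (n + j)] (mod q)"
      by (intro eventually_ball_finite ballI eventually_almost_all_shift[OF b_Suc]) auto
    then show ?thesis
    proof eventually_elim
      case (elim n)
      have const: "[b (n + j) = b n] (mod q)" if "j < q" for j
        using that
      proof (induction j)
        case (Suc j)
        then have "[b (Suc (n + j)) = b (n + j)] (mod q)" using elim by simp
        then show ?case using Suc by (simp, meson Suc_lessD cong_trans)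
      qed simp
      \<comment> \<open>Solves \<open>n + i \<equiv> b n\<close> modulo \<open>q\<close>, with
        \<open>(q - 1) * n\<close> playing the part of \<open>- n\<close> in the natural
        numbers.\<close>
      define i where "i = (b n + (q - 1) * n) mod q"
      have i: "i < q" using q1 by (simp add: i_def)
      have "(n + i) mod q = (n + (b n + (q - 1) * n)) mod q"
        by (simp add: i_def mod_add_right_eq)
      also have "n + (b n + (q - 1) * n) = b n + q * n"
      proof -
        have "n + (q - 1) * n = (1 + (q - 1)) * n" by (simp only: distrib_right mult_1)
        then show ?thesis using q1 by simp
      qed
      finally have "(n + i) mod q = b (n + i) mod q"
        using const[OF i] by (simp add: cong_def)
      moreover from this have "\<not> q dvd n + i" using b_ndvd[of "n + i"] by (simp add: dvd_eq_mod_eq_0)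
      ultimately have "n + i \<in> T" using T_nd by blast
      then show ?case using i by (auto simp: W_def)
    qed
  qed
  \<comment> \<open>Deleting \<open>W\<close> costs density 0 and ensures that every window of
    length \<open>q\<close> starting in \<open>S\<close> contains a point of \<open>T\<close>, hence
    one outside \<open>S\<close>.\<close>
  define S where "S = {1..} - T - W"
  have S_T: "\<forall>\<^sub>F n in almost_all. n \<in> S \<longleftrightarrow> n \<notin> T"
    using W pos by eventually_elim (auto simp: S_def)
  show ?thesis
  proof (intro exI conjI)
    show "S \<subseteq> {1..}" by (auto simp: S_def)
    show "stable_set S"
      unfolding stable_set_def
    proof (intro allI impI has_natural_density_0I)
      fix p :: nat assume p: "prime p"
      show "\<forall>\<^sub>F n in almost_all. n \<notin> {n. (n \<in> S) \<noteq> (p * n \<in> S)}"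
        using S_T eventually_almost_all_mult[OF S_T prime_gt_0_nat[OF p]] T_stable[OF p]
        by eventually_elim auto
    qed
    have "\<forall>\<^sub>F n in almost_all. n \<in> - T \<longleftrightarrow> n \<in> S"
      using S_T by eventually_elim auto
    then show "has_natural_density S (1 - 1 / (real q - 1))"
      by (rule has_natural_densityI[OF count_density_cong[OF _ compl_density]])
    show "(\<Inter>h\<in>{0..int q - 1}. shift_set S h) = {}"
    proof (rule ccontr)
      assume "(\<Inter>h\<in>{0..int q - 1}. shift_set S h) \<noteq> {}"
      then obtain z where z: "\<And>h. h \<in> {0..int q - 1} \<Longrightarrow> z \<in> shift_set S h" by blast
      \<comment> \<open>The shift by \<open>q - 1\<close> exhibits the least element
        \<open>n = z - (q - 1)\<close> of the window; the shift by \<open>q - 1 - i\<close> then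
        puts \<open>n + i\<close>, a point of \<open>T\<close>, into \<open>S\<close>.\<close>
      obtain n where n: "n \<in> S" "z = int n + (int q - 1)"
        using z[of "int q - 1"] q1 by (auto simp: shift_set_def)
      then obtain i where i: "i < q" "n + i \<in> T" by (auto simp: S_def W_def)
      obtain m where "m \<in> S" "z = int m + (int q - 1 - int i)"
        using z[of "int q - 1 - int i"] i q1 by (auto simp: shift_set_def)
      moreover from this have "m = n + i" using n by simp
      ultimately show False using i by (simp add: S_def)
    qed
  qed
qed

end
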